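(* Let $f:\mathbb{C}\to\widehat{\mathbb{C}}$ be a meromorphic map and let $U$ be a Baker domain of $f$ of period $p\ge 1$ such that $f^{pn}|_U\to\infty$ as $n\to\infty$ and such that $\mathbb{C}\setminus U$ has an unbounded connected component. Then there exists a sequence of points $p_n\in P(f)$ such that $$|p_n|\to\infty,\qquad \left|\frac{p_{n+1}}{p_n}\right|\to 1,\qquad \frac{\operatorname{dist}(p_n,U)}{|p_n|}\to 0$$ as $n\to\infty$.
   Context: $\widehat{\mathbb{C}}$ is the Riemann sphere and $\operatorname{dist}$ denotes Euclidean distance. For a meromorphic map $f:\mathbb{C}\to\widehat{\mathbb{C}}$, the Fatou set $F(f)$ is the set of points having a neighborhood on which all iterates $f^n$, $n>0$, are well defined and form a normal family; the Julia set is $J(f)=\widehat{\mathbb{C}}\setminus F(f)$. A Fatou component is a connected component of $F(f)$; it has period $p$ if $p\ge 1$ is the smallest integer with $f^p(U)\subset U$. A Baker domain here is a periodic Fatou component $U$, of period $p$, on which the iterates $f^{pn}$ converge to $\infty$, an essential singularity of $f$ (so $f$ is transcendental), uniformly on compact subsets of $U$ as $n\to\infty$. $S(f)\subset\mathbb{C}$ is the set of finite singular values of $f$, i.e. finite critical values and finite asymptotic values. The postsingular set is $$P(f)=\mathbb{C}\cap\bigcup_{s\in\overline{S(f)}}\bigcup_{n=0}^\infty f^n(s),$$ where terms that are undefined or infinite are neglected. *)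

theory Defs
  imports "HOL-Complex_Analysis.Complex_Analysis"
begin

section \<open>The Riemann sphere with the chordal metric\<close>

datatype riemann_sphere = Fin complex | Infty

text \<open>Inverse stereographic projection onto the unit sphere of \<open>complex \<times> real\<close> (Euclidean
  3-space), with \<open>Infty\<close> at the north pole. The metric is the resulting Euclidean chord length.\<close>

fun stereo :: "riemann_sphere \<Rightarrow> complex \<times> real" where
  "stereo (Fin z) = (complex_of_real (2 / (1 + (cmod z)\<^sup>2)) * z, ((cmod z)\<^sup>2 - 1) / ((cmod z)\<^sup>2 + 1))"
| "stereo Infty = (0, 1)"

lemma stereo_snd: "snd (stereo (Fin z)) = 1 - 2 / (1 + (cmod z)\<^sup>2)"
proof -
  have "1 + (cmod z)\<^sup>2 > 0" by (simp add: add_pos_nonneg)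
  then show ?thesis by (simp add: field_simps)
qed

lemma stereo_inj: "stereo x = stereo y \<Longrightarrow> x = y"
proof -
  have pos: "1 + (cmod z)\<^sup>2 > 0" for z :: complex by (simp add: add_pos_nonneg)
  have ne: "stereo (Fin z) \<noteq> stereo Infty" for z
    using stereo_snd[of z] pos[of z] by (auto simp: prod_eq_iff)
  have fin: "z = w" if eq: "stereo (Fin z) = stereo (Fin w)" for z w
  proof -
    have "2 / (1 + (cmod z)\<^sup>2) = 2 / (1 + (cmod w)\<^sup>2)"
      using arg_cong[OF eq, of snd] unfolding stereo_snd by linarith
    moreover have "complex_of_real (2 / (1 + (cmod z)\<^sup>2)) * z = complex_of_real (2 / (1 + (cmod w)\<^sup>2)) * w"
      using arg_cong[OF eq, of fst] by (simp only: stereo.simps fst_conv)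
    moreover have "2 / (1 + (cmod w)\<^sup>2) \<noteq> 0" using pos[of w] by simp
    ultimately show ?thesis
      by (metis mult_left_cancel of_real_eq_0_iff)
  qed
  show "stereo x = stereo y \<Longrightarrow> x = y"
    using ne fin by (cases x; cases y) metis+
qed

instantiation riemann_sphere :: metric_space
begin

definition dist_riemann_sphere :: "riemann_sphere \<Rightarrow> riemann_sphere \<Rightarrow> real" where
  "dist_riemann_sphere x y = dist (stereo x) (stereo y)"

definition uniformity_riemann_sphere :: "(riemann_sphere \<times> riemann_sphere) filter" where
  "uniformity_riemann_sphere = (INF e\<in>{0<..}. principal {(x, y). dist x y < e})"

definition open_riemann_sphere :: "riemann_sphere set \<Rightarrow> bool" where
  "open_riemann_sphere S \<longleftrightarrow> (\<forall>x\<in>S. eventually (\<lambda>(x', y). x' = x \<longrightarrow> y \<in> S) uniformity)"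

instance
proof
  fix x y z :: riemann_sphere
  show "dist x y = 0 \<longleftrightarrow> x = y"
    using stereo_inj by (auto simp: dist_riemann_sphere_def)
  show "dist x y \<le> dist x z + dist y z"
    by (simp add: dist_riemann_sphere_def dist_triangle2)
qed (rule uniformity_riemann_sphere_def open_riemann_sphere_def)+

end

section \<open>Meromorphic maps and their iterates\<close>

text \<open>A meromorphic map from the plane to the sphere is given by a function \<open>f\<close> with
  \<open>f nicely_meromorphic_on UNIV\<close>. That predicate stores the dummy value 0 at the poles,
  so the actual map into the sphere is the following one.\<close>

definition sphere_map :: "(complex \<Rightarrow> complex) \<Rightarrow> complex \<Rightarrow> riemann_sphere" where
  "sphere_map f z = (if is_pole f z then Infty else Fin (f z))"

text \<open>The map is not defined at \<open>Infty\<close>, so \<open>f\<^sup>n(z)\<close> is defined iff \<open>z, f(z), \<dots>, f\<^sup>n\<^sup>-\<^sup>1(z)\<close> are all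
  finite. Where it is undefined, \<open>iter f n z\<close> has the dummy value \<open>Infty\<close>.\<close>

primrec iter :: "(complex \<Rightarrow> complex) \<Rightarrow> nat \<Rightarrow> complex \<Rightarrow> riemann_sphere" where
  "iter f 0 z = Fin z"
| "iter f (Suc n) z = (case iter f n z of Fin w \<Rightarrow> sphere_map f w | Infty \<Rightarrow> Infty)"

definition iter_defined :: "(complex \<Rightarrow> complex) \<Rightarrow> nat \<Rightarrow> complex \<Rightarrow> bool" where
  "iter_defined f n z \<longleftrightarrow> (\<forall>k<n. iter f k z \<noteq> Infty)"

definition normal_family_on :: "(complex \<Rightarrow> riemann_sphere) set \<Rightarrow> complex set \<Rightarrow> bool" where
  "normal_family_on \<F> V \<longleftrightarrow>
     (\<forall>h :: nat \<Rightarrow> complex \<Rightarrow> riemann_sphere. range h \<subseteq> \<F> \<longrightarrow>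
        (\<exists>r g. strict_mono (r :: nat \<Rightarrow> nat) \<and>
           (\<forall>K. compact K \<and> K \<subseteq> V \<longrightarrow> uniform_limit K (\<lambda>j. h (r j)) g sequentially)))"

text \<open>As \<open>Infty\<close> is not in the domain of the map, the Fatou set lies in the plane.\<close>

definition fatou_set :: "(complex \<Rightarrow> complex) \<Rightarrow> complex set" where
  "fatou_set f = {z. \<exists>V. open V \<and> z \<in> V \<and> (\<forall>n>0. \<forall>w\<in>V. iter_defined f n w) \<and>
     normal_family_on {iter f n | n. n > 0} V}"

definition has_period :: "(complex \<Rightarrow> complex) \<Rightarrow> complex set \<Rightarrow> nat \<Rightarrow> bool" where
  "has_period f U p \<longleftrightarrow> p \<ge> 1 \<and> iter f p ` U \<subseteq> Fin ` U \<and>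
     (\<forall>q. 1 \<le> q \<and> q < p \<longrightarrow> \<not> iter f q ` U \<subseteq> Fin ` U)"

text \<open>Poles may accumulate at infinity, so that infinity need not be an isolated singularity.
  It is essential if the map has no limit there in the sphere.\<close>

definition essential_at_infinity :: "(complex \<Rightarrow> complex) \<Rightarrow> bool" where
  "essential_at_infinity f \<longleftrightarrow> \<not> (\<exists>l. (sphere_map f \<longlongrightarrow> l) at_infinity)"

definition baker_domain :: "(complex \<Rightarrow> complex) \<Rightarrow> complex set \<Rightarrow> nat \<Rightarrow> bool" where
  "baker_domain f U p \<longleftrightarrow> essential_at_infinity f \<and> U \<in> components (fatou_set f) \<and>
     has_period f U p \<and>
     (\<forall>K. compact K \<and> K \<subseteq> U \<longrightarrow> uniform_limit K (\<lambda>n. iter f (p * n)) (\<lambda>_. Infty) sequentially)"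

section \<open>Singular values and the postsingular set\<close>

definition critical_values :: "(complex \<Rightarrow> complex) \<Rightarrow> complex set" where
  "critical_values f = {f z | z. \<not> is_pole f z \<and> deriv f z = 0}"

definition asymptotic_values :: "(complex \<Rightarrow> complex) \<Rightarrow> complex set" where
  "asymptotic_values f = {a. \<exists>\<gamma> :: real \<Rightarrow> complex. continuous_on {0..} \<gamma> \<and>
     filterlim \<gamma> at_infinity at_top \<and> ((\<lambda>t. sphere_map f (\<gamma> t)) \<longlongrightarrow> Fin a) at_top}"

definition singular_values :: "(complex \<Rightarrow> complex) \<Rightarrow> complex set" where
  "singular_values f = critical_values f \<union> asymptotic_values f"

definition postsingular_set :: "(complex \<Rightarrow> complex) \<Rightarrow> complex set" where
  "postsingular_set f = {w. \<exists>s\<in>closure (singular_values f). \<exists>n. iter f n s = Fin w}"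

end

(* A point of U is followed under f^(pn) to u_n, and u_n is joined along the circle |w| = |u_n| to the
   nearest point of the complement of U, which is not in the Fatou set; such a point exists because the
   complement has an unbounded component. If a neighbourhood of this arc of size comparable to
   \<epsilon> |u_n| misses P(f), then a branch of the inverse of f^(pn) exists on it. These branches, taken
   over a fixed domain in the logarithmic coordinate, form a normal family, because each of them omits
   one point of every pair {a, b} with f(a) = f(b). A constant limit is impossible, since it would push
   points outside the Fatou set into it. Under a nonconstant limit all iterates are injective on a
   fixed disc that meets the Julia set, hence they omit values there in the same way and are normal by
   Montel, a contradiction. So P(f) meets all these neighbourhoods for large n, and since the images
   under f^(pn) of a path from z to f^p(z) meet all large circles, it meets them at all large radii. *)

theory Submission
  imports Defs
begin

section \<open>The sphere and iterates\<close>

text \<open>Montel needs two omitted values common to infinitely many maps. They come from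
  non-injectivity: an injective \<open>f\<close> would extend continuously to infinity as a map into
  the sphere, contrary to the essential singularity. Openness of \<open>f\<close> then yields two
  disjoint pairs with equal images, and among the four ways to miss a point of each pair one recurs
  infinitely often. For this the arcs with their neighbourhoods must be parametrised injectively;
  hence the turn by at most half a circle and the bound on the thickness. The inverse branches start
  in a compact subset of U, so infinity is excluded as their limit. The iterates near the limit
  point may tend to infinity, so normality there is meant in the chordal metric. A single orbit
  would not be enough: the quotient of the moduli of f^(p(n+1))(z) and f^(pn)(z) need not tend to 1.
  Therefore the estimate is made uniform over a compact set, and a path fills the gaps between the
  radii.\<close>

lemma iter_Suc_eq_Fin:
  "iter f (Suc n) z = Fin w \<longleftrightarrow> (\<exists>v. iter f n z = Fin v \<and> \<not> is_pole f v \<and> f v = w)"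
  by (auto simp: sphere_map_def split: riemann_sphere.splits if_splits)

lemma iter_add:
  "iter f (m + n) z = (case iter f m z of Fin w \<Rightarrow> iter f n w | Infty \<Rightarrow> Infty)"
  by (induction n) (auto split: riemann_sphere.splits)

lemma iter_finite_mono:
  assumes "iter f n z \<noteq> Infty" "k \<le> n"
  shows "iter f k z \<noteq> Infty"
  using assms iter_add[of f k "n - k" z] by auto

text \<open>Past a pole, \<open>f ^^ n\<close> runs on with the stored dummy value 0, so it
  represents the iterate only while the latter is finite.\<close>

lemma iter_eq_funpow:
  "iter f n z \<noteq> Infty \<Longrightarrow> iter f n z = Fin ((f ^^ n) z)"
  by (induction n) (auto simp: sphere_map_def split: riemann_sphere.splits if_splits)

lemma iter_finite_not_pole:
  assumes "iter f (Suc n) z \<noteq> Infty"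
  shows "\<not> is_pole f ((f ^^ n) z)"
proof -
  have "iter f n z = Fin ((f ^^ n) z)"
    using assms by (intro iter_eq_funpow iter_finite_mono[OF assms]) auto
  then show ?thesis
    using assms by (auto simp: sphere_map_def)
qed

lemma iter_funpow_analytic:
  assumes f: "f nicely_meromorphic_on UNIV" and fin: "\<And>w. w \<in> A \<Longrightarrow> iter f n w \<noteq> Infty"
  shows "(f ^^ n) analytic_on A"
  using fin
proof (induction n)
  case 0
  then show ?case by (simp add: id_def)
next
  case (Suc n)
  have an: "(f ^^ n) analytic_on A"
    using Suc.prems iter_finite_mono[of f "Suc n" _ n] by (intro Suc.IH) auto
  have "f analytic_on (f ^^ n) ` A"
    unfolding analytic_on_analytic_at[of f "(f ^^ n) ` A"]
    using iter_finite_not_pole[OF Suc.prems] nicely_meromorphic_on_imp_analytic_at[OF f] by auto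
  then show ?case
    using analytic_on_compose[OF an] by (simp add: comp_def)
qed

lemma dist_Fin_Infty: "dist (Fin z) Infty = 2 / sqrt (1 + (cmod z)\<^sup>2)"
proof -
  define s where "s = 1 + (cmod z)\<^sup>2"
  have s: "s > 0" by (simp add: s_def add_pos_nonneg)
  have 2: "((cmod z)\<^sup>2 - 1) / ((cmod z)\<^sup>2 + 1) - 1 = - 2 / s"
    using s by (simp add: s_def field_simps)
  have "(dist (Fin z) Infty)\<^sup>2 = (cmod (complex_of_real (2 / s) * z))\<^sup>2 + (- 2 / s)\<^sup>2"
    unfolding dist_riemann_sphere_def dist_prod_def stereo.simps fst_conv snd_conv dist_norm 2
    by (simp add: s_def)
  also have "\<dots> = (2 / s)\<^sup>2 * (cmod z)\<^sup>2 + (2 / s)\<^sup>2"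
    unfolding norm_mult norm_of_real power_mult_distrib power2_abs power2_minus minus_divide_left[symmetric] by simp
  also have "\<dots> = (2 / s)\<^sup>2 * s" by (simp add: s_def algebra_simps)
  also have "\<dots> = (2 / sqrt s)\<^sup>2" using s by (simp add: power_divide power2_eq_square)
  finally show ?thesis
    using s by (auto simp: s_def power2_eq_iff_nonneg)
qed

lemma continuous_on_stereo_iff:
  fixes f :: "'a::metric_space \<Rightarrow> riemann_sphere"
  shows "continuous_on S f \<longleftrightarrow> continuous_on S (\<lambda>x. stereo (f x))"
  by (simp add: continuous_on_iff dist_riemann_sphere_def)

lemma continuous_on_Fin: "continuous_on S Fin"
proof -
  have *: "1 + (cmod z)\<^sup>2 \<noteq> 0" "(cmod z)\<^sup>2 + 1 \<noteq> 0" for z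
    by (smt (verit) zero_le_power2)+
  have "1 + (complex_of_real (cmod z))\<^sup>2 \<noteq> 0" for z
    using *(1)[of z] by (metis of_real_0 of_real_1 of_real_add of_real_eq_iff of_real_power)
  with * show ?thesis
    unfolding continuous_on_stereo_iff by (auto intro!: continuous_intros)
qed

text \<open>Serves to return from reciprocals \<open>1 / (F - a)\<close> to \<open>F\<close> on the
  sphere: zeros of a limit of reciprocals become \<open>Infty\<close>.\<close>

lemma continuous_on_shifted_inversion:
  "continuous_on S (\<lambda>x. if x = 0 then Infty else Fin (a + 1 / x))"
proof -
  \<comment> \<open>In homogeneous coordinates the point is [a x + 1 : x]. The two coordinates never
    vanish together, so stereographic projection has a formula without a case split.\<close>
  define y where "y x = a * x + 1" for x
  have pos: "(cmod x)\<^sup>2 + (cmod (y x))\<^sup>2 \<noteq> 0" for x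
    unfolding sum_power2_eq_zero_iff by (auto simp: y_def)
  have eq: "stereo (if x = 0 then Infty else Fin (a + 1 / x)) =
      (2 * y x * cnj x / complex_of_real ((cmod x)\<^sup>2 + (cmod (y x))\<^sup>2),
       ((cmod (y x))\<^sup>2 - (cmod x)\<^sup>2) / ((cmod x)\<^sup>2 + (cmod (y x))\<^sup>2))" for x
  proof (cases "x = 0")
    case False
    have e: "a + 1 / x = y x / x" using False by (simp add: y_def field_simps)
    have n: "(cmod (y x / x))\<^sup>2 = (cmod (y x))\<^sup>2 / (cmod x)\<^sup>2"
      by (simp add: norm_divide power_divide)
    have p: "(cmod x)\<^sup>2 + (cmod (y x))\<^sup>2 > 0" "(cmod x)\<^sup>2 > 0"
      using pos[of x] False by (auto simp: less_le)
    have 1: "2 / (1 + (cmod (y x))\<^sup>2 / (cmod x)\<^sup>2) = 2 * (cmod x)\<^sup>2 / ((cmod x)\<^sup>2 + (cmod (y x))\<^sup>2)"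
      using p by (simp add: field_simps)
    have 2: "((cmod (y x))\<^sup>2 / (cmod x)\<^sup>2 - 1) / ((cmod (y x))\<^sup>2 / (cmod x)\<^sup>2 + 1) =
      ((cmod (y x))\<^sup>2 - (cmod x)\<^sup>2) / ((cmod x)\<^sup>2 + (cmod (y x))\<^sup>2)"
      using p by (simp add: divide_simps)
    have 3: "complex_of_real ((cmod x)\<^sup>2) = x * cnj x" by (rule complex_norm_square)
    have "complex_of_real (2 * (cmod x)\<^sup>2 / ((cmod x)\<^sup>2 + (cmod (y x))\<^sup>2)) * (y x / x) =
       2 * y x * cnj x / complex_of_real ((cmod x)\<^sup>2 + (cmod (y x))\<^sup>2)"
      unfolding of_real_divide of_real_mult[of 2] 3 using False by simp
    then show ?thesis
      using False unfolding e by (simp add: n 1 2)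
  qed (simp add: y_def)
  have p': "complex_of_real ((cmod x)\<^sup>2 + (cmod (y x))\<^sup>2) \<noteq> 0" for x
    using pos[of x] of_real_eq_0_iff by blast
  show ?thesis
    unfolding continuous_on_stereo_iff eq
    by (intro continuous_intros ballI pos p') (auto simp: y_def intro!: continuous_intros)
qed

text \<open>The limit is bounded on \<open>K\<close>, so the values eventually lie in one closed
  ball, on which \<open>T\<close> is uniformly continuous.\<close>

lemma uniform_limit_continuous_comp:
  fixes T :: "complex \<Rightarrow> 'a::metric_space"
  assumes T: "continuous_on UNIV T" and ul: "uniform_limit K F g sequentially"
    and g: "continuous_on K g" and K: "compact K"
  shows "uniform_limit K (\<lambda>n x. T (F n x)) (\<lambda>x. T (g x)) sequentially"
proof -
  obtain B where B: "\<And>x. x \<in> K \<Longrightarrow> cmod (g x) \<le> B"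
    using compact_imp_bounded[OF compact_continuous_image[OF g K]]
    by (auto simp: bounded_iff)
  have "\<forall>\<^sub>F n in sequentially. \<forall>x\<in>K. dist (F n x) (g x) < 1"
    using ul unfolding uniform_limit_iff by auto
  then have ev: "\<forall>\<^sub>F n in sequentially. \<forall>x\<in>K. F n x \<in> cball 0 (B + 1)"
    by eventually_elim (smt (verit, best) B dist_norm dist_commute mem_cball_0 norm_triangle_sub)
  show ?thesis
    by (rule uniform_limit_compose_uniformly_continuous_on[OF ul _ ev])
      (auto intro!: compact_uniformly_continuous continuous_on_subset[OF T])
qed

lemma fatou_set_open: "open (fatou_set f)"
  by (subst open_subopen) (unfold fatou_set_def, blast)

lemma fatou_set_iter_finite: "z \<in> fatou_set f \<Longrightarrow> iter f n z \<noteq> Infty"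
  unfolding fatou_set_def iter_defined_def by blast

section \<open>Functions omitting two values\<close>

text \<open>Schottky's theorem rescaled to a disc of radius \<rho>; the summand 12 is its term 12 t
  / (1 - t) at t = 1/2.\<close>

lemma schottky_cball:
  assumes holf: "h holomorphic_on cball w \<rho>" and "0 < \<rho>" and "cmod (h w) \<le> B"
    and omit: "\<And>z. z \<in> cball w \<rho> \<Longrightarrow> h z \<noteq> 0 \<and> h z \<noteq> 1"
    and z: "z \<in> cball w (\<rho> / 2)"
  shows "cmod (h z) \<le> exp (pi * exp (pi * (2 + 2 * B + 12)))"
proof -
  define x where "x = (z - w) / of_real \<rho>"
  have img: "w + of_real \<rho> * y \<in> cball w \<rho>" if "y \<in> cball 0 1" for y
    using that \<open>0 < \<rho>\<close> by (auto simp: dist_norm norm_mult mult_le_cancel_left2)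
  have "cmod (h (w + of_real \<rho> * x)) \<le> exp (pi * exp (pi * (2 + 2 * B + 12 * (1/2) / (1 - 1/2))))"
  proof (rule Schottky[where f = "\<lambda>y. h (w + of_real \<rho> * y)" and z = x])
    show "(\<lambda>y. h (w + of_real \<rho> * y)) holomorphic_on cball 0 1"
      using img by (intro holomorphic_on_compose_gen[OF _ holf, of "\<lambda>y. w + of_real \<rho> * y", unfolded o_def])
        (auto intro!: holomorphic_intros)
    show "cmod x \<le> 1 / 2"
      using z \<open>0 < \<rho>\<close> by (simp add: x_def dist_norm norm_divide norm_minus_commute field_simps)
  qed (use assms img in auto)
  then show ?thesis using \<open>0 < \<rho>\<close> by (simp add: x_def)
qed

text \<open>By Schottky's theorem a common bound at a point spreads to the concentric half of any
  closed disc in \<open>S\<close>. So the points with a common bound form an open and relatively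
  closed subset of the connected set \<open>S\<close>; compactness then gives one bound on
  \<open>K\<close>.\<close>

lemma omitting_family_bounded:
  assumes S: "open S" "connected S" "w \<in> S"
    and hol: "\<And>h. h \<in> Y \<Longrightarrow> h holomorphic_on S"
    and omit: "\<And>h z. h \<in> Y \<Longrightarrow> z \<in> S \<Longrightarrow> h z \<noteq> 0 \<and> h z \<noteq> 1"
    and bd: "\<And>h. h \<in> Y \<Longrightarrow> cmod (h w) \<le> B0"
    and K: "compact K" "K \<subseteq> S"
  shows "\<exists>B. \<forall>h\<in>Y. \<forall>z\<in>K. cmod (h z) \<le> B"
proof -
  define M where "M B = exp (pi * exp (pi * (2 + 2 * B + 12)))" for B
  define U where "U = {z \<in> S. \<exists>B. \<forall>h\<in>Y. cmod (h z) \<le> B}"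
  have step: "\<forall>h\<in>Y. \<forall>x\<in>cball z (\<rho> / 2). cmod (h x) \<le> M B"
    if "cball z \<rho> \<subseteq> S" "0 < \<rho>" "\<forall>h\<in>Y. cmod (h z) \<le> B" for z \<rho> B
  proof (intro ballI)
    fix h x assume h: "h \<in> Y" and x: "x \<in> cball z (\<rho> / 2)"
    show "cmod (h x) \<le> M B" unfolding M_def
    proof (rule schottky_cball[OF _ that(2) _ _ x])
      show "h holomorphic_on cball z \<rho>" using holomorphic_on_subset[OF hol[OF h] that(1)] .
    qed (use that omit h in auto)
  qed
  have "U = S"
  proof (rule ccontr)
    assume "U \<noteq> S"
    have "U \<subseteq> S" by (auto simp: U_def)
    have 1: "\<exists>e>0. ball z e \<subseteq> U" if z: "z \<in> U" for z
    proof -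
      obtain \<rho> where \<rho>: "\<rho> > 0" "cball z \<rho> \<subseteq> S"
        using z S(1) \<open>U \<subseteq> S\<close> open_contains_cball by blast
      obtain B where "\<forall>h\<in>Y. cmod (h z) \<le> B" using z by (auto simp: U_def)
      from step[OF \<rho>(2,1) this] have "\<forall>h\<in>Y. cmod (h x) \<le> M B" if "x \<in> ball z (\<rho> / 2)" for x
        using that by auto
      then have "ball z (\<rho> / 2) \<subseteq> U"
        using \<rho>(2) ball_subset_cball[of z "\<rho> / 2"] subset_cball[of "\<rho> / 2" \<rho> z] \<rho>(1)
        unfolding U_def by (intro subsetI CollectI conjI exI[of _ "M B"]) auto
      then show ?thesis using \<rho> by (metis half_gt_zero)
    qed
    have 2: "\<exists>e>0. ball z e \<subseteq> S - U" if z: "z \<in> S - U" for z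
    proof -
      obtain \<rho> where \<rho>: "\<rho> > 0" "cball z \<rho> \<subseteq> S"
        using z S(1) unfolding open_contains_cball by (metis DiffD1)
      \<comment> \<open>With a quarter of the radius, the disc of radius \<rho>/2 about
        \<open>x\<close> still lies in \<open>S\<close> and its half contains \<open>z\<close>, so a
        bound at \<open>x\<close> would spread back to \<open>z\<close>.\<close>
      have "x \<notin> U" if x: "x \<in> ball z (\<rho> / 4)" for x
      proof
        assume "x \<in> U"
        then obtain B where B: "\<forall>h\<in>Y. cmod (h x) \<le> B" by (auto simp: U_def)
        have "cball x (\<rho> / 2) \<subseteq> cball z \<rho>" "z \<in> cball x (\<rho> / 2 / 2)"
          using x \<rho> by (auto simp: subset_iff dist_commute) (smt (verit) dist_triangle dist_commute)
        then have "\<forall>h\<in>Y. cmod (h z) \<le> M B"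
          using step[OF order_trans[OF _ \<rho>(2)], of x "\<rho> / 2" B] \<rho>(1) B by simp
        then show False using z by (auto simp: U_def)
      qed
      moreover have "ball z (\<rho> / 4) \<subseteq> S" using \<rho> by (auto simp: subset_iff)
      ultimately show ?thesis using \<rho> by (intro exI[of _ "\<rho> / 4"]) auto
    qed
    have "open U" "open (S - U)" using 1 2 by (auto simp: open_contains_ball)
    moreover have "w \<in> U" using S(3) bd by (auto simp: U_def)
    moreover have "S \<subseteq> U \<union> (S - U)" "U \<inter> (S - U) \<inter> S = {}" "U \<inter> S \<noteq> {}" "(S - U) \<inter> S \<noteq> {}"
      using \<open>w \<in> U\<close> S(3) \<open>U \<noteq> S\<close> \<open>U \<subseteq> S\<close> by auto
    ultimately show False
      using connectedD[OF S(2), of U "S - U"] by simp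
  qed
  have "\<exists>e B. e > 0 \<and> (\<forall>h\<in>Y. \<forall>x\<in>ball z e. cmod (h x) \<le> B)" if z: "z \<in> K" for z
  proof -
    obtain \<rho> where \<rho>: "\<rho> > 0" "cball z \<rho> \<subseteq> S"
      using z K S(1) unfolding open_contains_cball by blast
    obtain B where "\<forall>h\<in>Y. cmod (h z) \<le> B" using subsetD[OF K(2) z] unfolding \<open>U = S\<close>[symmetric] by (auto simp: U_def)
    from step[OF \<rho>(2,1) this] show ?thesis
      using \<rho> by (intro exI[of _ "\<rho>/2"] exI[of _ "M B"]) auto
  qed
  then have "\<forall>z\<in>K. \<exists>e B. e > 0 \<and> (\<forall>h\<in>Y. \<forall>x\<in>ball z e. cmod (h x) \<le> B)" by blast
  from bchoice[OF this] obtain e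
    where "\<forall>z\<in>K. \<exists>B. e z > 0 \<and> (\<forall>h\<in>Y. \<forall>x\<in>ball z (e z). cmod (h x) \<le> B)" ..
  from bchoice[OF this] obtain B
    where eB: "\<forall>z\<in>K. e z > 0 \<and> (\<forall>h\<in>Y. \<forall>x\<in>ball z (e z). cmod (h x) \<le> B z)" ..
  have "K \<subseteq> (\<Union>c\<in>K. ball c (e c))" using eB by force
  then obtain C where C: "C \<subseteq> K" "finite C" "K \<subseteq> (\<Union>c\<in>C. ball c (e c))"
    using compactE_image[OF K(1), of K "\<lambda>c. ball c (e c)"] by auto
  show ?thesis
  proof (intro exI[of _ "\<Sum>c\<in>C. \<bar>B c\<bar>"] ballI)
    fix h z assume h: "h \<in> Y" "z \<in> K"
    then obtain c where c: "c \<in> C" "z \<in> ball c (e c)" using C by auto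
    then have "cmod (h z) \<le> B c" using eB C h by blast
    also have "\<dots> \<le> \<bar>B c\<bar>" by simp
    also have "\<dots> \<le> (\<Sum>c\<in>C. \<bar>B c\<bar>)" using c C by (intro member_le_sum) auto
    finally show "cmod (h z) \<le> (\<Sum>c\<in>C. \<bar>B c\<bar>)" .
  qed
qed

lemma omitting_affine_bounded:
  assumes S: "open S" "connected S" "w \<in> S" and "a \<noteq> b"
    and hol: "\<And>h. h \<in> Y \<Longrightarrow> h holomorphic_on S"
    and omit: "\<And>h z. h \<in> Y \<Longrightarrow> z \<in> S \<Longrightarrow> h z \<noteq> a \<and> h z \<noteq> b"
    and bd: "\<And>h. h \<in> Y \<Longrightarrow> cmod (h w) \<le> B0"
    and K: "compact K" "K \<subseteq> S"
  shows "\<exists>B. \<forall>h\<in>Y. \<forall>z\<in>K. cmod (h z) \<le> B"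
proof -
  define T where "T h = (\<lambda>z. (h z - a) / (b - a))" for h :: "complex \<Rightarrow> complex"
  have "\<exists>B. \<forall>h\<in>T ` Y. \<forall>z\<in>K. cmod (h z) \<le> B"
  proof (rule omitting_family_bounded[OF S _ _ _ K])
    fix h assume "h \<in> T ` Y"
    then obtain h0 where h0: "h0 \<in> Y" "h = T h0" by auto
    show "h holomorphic_on S" using h0 hol \<open>a \<noteq> b\<close> by (auto simp: T_def intro!: holomorphic_intros)
    show "h z \<noteq> 0 \<and> h z \<noteq> 1" if "z \<in> S" for z
      using h0 omit[OF h0(1) that] \<open>a \<noteq> b\<close> by (auto simp: T_def)
    have "cmod (h0 w - a) \<le> B0 + cmod a" using bd[OF h0(1)] norm_triangle_ineq4[of "h0 w" a] by linarith
    then show "cmod (h w) \<le> (B0 + cmod a) / cmod (b - a)"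
      using h0 \<open>a \<noteq> b\<close> by (auto simp: T_def norm_divide divide_right_mono)
  qed
  then obtain B where B: "\<And>h z. h \<in> Y \<Longrightarrow> z \<in> K \<Longrightarrow> cmod (T h z) \<le> B" by auto
  show ?thesis
  proof (intro exI[of _ "B * cmod (b - a) + cmod a"] ballI)
    fix h z assume "h \<in> Y" "z \<in> K"
    from B[OF this] have "cmod (h z - a) \<le> B * cmod (b - a)"
      using \<open>a \<noteq> b\<close> by (simp add: T_def norm_divide divide_simps)
    then show "cmod (h z) \<le> B * cmod (b - a) + cmod a"
      by (smt (verit) norm_triangle_sub)
  qed
qed

text \<open>If infinitely many values at \<open>w\<close> are near \<open>a\<close>, a finite limit
  exists. Otherwise the reciprocals of \<open>F - a\<close> omit 0 and \<open>1 / (b - a)\<close>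
  and are bounded by 1 at \<open>w\<close>; where their limit vanishes, the spherical limit is
  \<open>Infty\<close>.\<close>

lemma omitting_sequence_normal:
  assumes S: "open S" "connected S" "w \<in> S" and "a \<noteq> b"
    and hol: "\<And>n. F n holomorphic_on S"
    and omit: "\<And>n z. z \<in> S \<Longrightarrow> F n z \<noteq> a \<and> F n z \<noteq> b"
  shows "\<exists>r g. strict_mono (r :: nat \<Rightarrow> nat) \<and>
    (\<forall>K. compact K \<and> K \<subseteq> S \<longrightarrow> uniform_limit K (\<lambda>j z. Fin (F (r j) z)) g sequentially)"
proof -
  have inf: "infinite {n. cmod (F n w - a) \<le> 1} \<or> infinite {n. \<not> cmod (F n w - a) \<le> 1}"
    (is "infinite ?A \<or> infinite ?B")
  proof -
    have "?A \<union> ?B = UNIV" by auto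
    then show ?thesis by (metis finite_Un infinite_UNIV_nat)
  qed
  show ?thesis
  proof (cases "infinite ?A")
    case True
    then obtain r where r: "strict_mono (r :: nat \<Rightarrow> nat)" "\<And>n. r n \<in> ?A"
      using infinite_enumerate by blast
    have bd: "cmod (F (r n) w) \<le> 1 + cmod a" for n
      using r(2)[of n] norm_triangle_sub[of "F (r n) w" a] by simp
    obtain g s where g: "g holomorphic_on S" "strict_mono (s :: nat \<Rightarrow> nat)"
      "\<And>K. \<lbrakk>compact K; K \<subseteq> S\<rbrakk> \<Longrightarrow> uniform_limit K ((\<lambda>n. F (r n)) \<circ> s) g sequentially"
    proof (rule Montel[OF S(1), of "range (\<lambda>n. F (r n))" "\<lambda>n. F (r n)"])
      fix K assume K: "compact K" "K \<subseteq> S"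
      show "\<exists>B. \<forall>h\<in>range (\<lambda>n. F (r n)). \<forall>z\<in>K. cmod (h z) \<le> B"
        by (rule omitting_affine_bounded[OF S \<open>a \<noteq> b\<close> _ _ _ K]) (use hol omit bd in auto)
    qed (use hol in auto)
    show ?thesis
    proof (intro exI[of _ "r \<circ> s"] exI[of _ "\<lambda>z. Fin (g z)"] conjI allI impI)
      show "strict_mono (r \<circ> s)" using r g by (simp add: strict_mono_o)
      fix K assume "compact K \<and> K \<subseteq> S"
      then show "uniform_limit K (\<lambda>j z. Fin (F ((r \<circ> s) j) z)) (\<lambda>z. Fin (g z)) sequentially"
        using uniform_limit_continuous_comp[OF continuous_on_Fin, where K = K and F = "\<lambda>j. F ((r \<circ> s) j)" and g = g]
          g(3)[of K] continuous_on_subset[OF holomorphic_on_imp_continuous_on[OF g(1)], of K]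
        by (simp add: o_def)
    qed
  next
    case False
    then have "infinite ?B" using inf by auto
    then obtain r where r: "strict_mono (r :: nat \<Rightarrow> nat)" "\<And>n. r n \<in> ?B"
      using infinite_enumerate by blast
    define k where "k n = (\<lambda>z. 1 / (F (r n) z - a))" for n
    have Fk: "k n z \<noteq> 0" "F (r n) z = a + 1 / k n z" if "z \<in> S" for n z
      using omit[OF that, of "r n"] by (auto simp: k_def)
    obtain g s where g: "g holomorphic_on S" "strict_mono (s :: nat \<Rightarrow> nat)"
      "\<And>K. \<lbrakk>compact K; K \<subseteq> S\<rbrakk> \<Longrightarrow> uniform_limit K (k \<circ> s) g sequentially"
    proof (rule Montel[OF S(1), of "range k" k])
      show holk: "h holomorphic_on S" if "h \<in> range k" for h
        using that omit hol by (auto simp: k_def intro!: holomorphic_intros)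
      fix K assume K: "compact K" "K \<subseteq> S"
      show "\<exists>B. \<forall>h\<in>range k. \<forall>z\<in>K. cmod (h z) \<le> B"
      proof (rule omitting_affine_bounded[OF S _ holk _ _ K])
        show "0 \<noteq> 1 / (b - a)" using \<open>a \<noteq> b\<close> by simp
        show "h z \<noteq> 0 \<and> h z \<noteq> 1 / (b - a)" if "h \<in> range k" "z \<in> S" for h z
        proof -
          obtain n where "h = k n" using \<open>h \<in> range k\<close> by auto
          then show ?thesis using omit[OF \<open>z \<in> S\<close>, of "r n"] \<open>a \<noteq> b\<close> by (auto simp: k_def divide_simps)
        qed
        show "cmod (h w) \<le> 1" if "h \<in> range k" for h
        proof -
          obtain n where "h = k n" using \<open>h \<in> range k\<close> by auto
          then show ?thesis using r(2)[of n] by (simp add: k_def norm_divide divide_le_eq)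
        qed
      qed
    qed auto
    define T where "T x = (if x = 0 then Infty else Fin (a + 1 / x))" for x
    show ?thesis
    proof (intro exI[of _ "r \<circ> s"] exI[of _ "\<lambda>z. T (g z)"] conjI allI impI)
      show "strict_mono (r \<circ> s)" using r g by (simp add: strict_mono_o)
      fix K assume K: "compact K \<and> K \<subseteq> S"
      have "continuous_on K g"
        using continuous_on_subset[OF holomorphic_on_imp_continuous_on[OF g(1)]] K by blast
      moreover have "uniform_limit K (\<lambda>j. k (s j)) g sequentially"
        using g(3)[of K] K by (simp add: o_def)
      moreover have "continuous_on UNIV T"
        unfolding T_def[abs_def] by (rule continuous_on_shifted_inversion)
      ultimately have "uniform_limit K (\<lambda>j z. T (k (s j) z)) (\<lambda>z. T (g z)) sequentially"
        using K uniform_limit_continuous_comp by blast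
      moreover have "T (k (s j) z) = Fin (F ((r \<circ> s) j) z)" if "z \<in> K" for j z
        using Fk[of z "s j"] that K by (auto simp: T_def)
      ultimately show "uniform_limit K (\<lambda>j z. Fin (F ((r \<circ> s) j) z)) (\<lambda>z. T (g z)) sequentially"
        by (simp add: uniform_limit_iff)
    qed
  qed
qed

section \<open>Normality of injective iterates and invariance of the Fatou set\<close>

text \<open>If an iterate took both values of a pair, the next one would not be injective. So each iterate
  omits one value of each pair, and infinitely many of them omit the same two values.\<close>

lemma injective_iterates_fatou:
  assumes f: "f nicely_meromorphic_on UNIV" and "0 < \<rho>"
    and fin: "\<And>m x. x \<in> ball w \<rho> \<Longrightarrow> iter f m x \<noteq> Infty"
    and inj: "\<And>m. inj_on (f ^^ m) (ball w \<rho>)"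
    and pairs: "f a1 = f b1" "f a2 = f b2" "distinct [a1, b1, a2, b2]"
  shows "w \<in> fatou_set f"
proof -
  let ?S = "ball w \<rho>"
  have omit: "(\<forall>z\<in>?S. (f ^^ n) z \<noteq> a) \<or> (\<forall>z\<in>?S. (f ^^ n) z \<noteq> b)"
    if "f a = f b" "a \<noteq> b" for a b n
  proof (rule ccontr)
    assume "\<not> ?thesis"
    then obtain x y where xy: "x \<in> ?S" "y \<in> ?S" "(f ^^ n) x = a" "(f ^^ n) y = b" by auto
    then have "(f ^^ Suc n) x = (f ^^ Suc n) y" using that by simp
    then have "x = y" using inj_onD[OF inj[of "Suc n"]] xy(1,2) by blast
    then show False using xy that by simp
  qed
  have "normal_family_on {iter f n |n. n > 0} ?S"
    unfolding normal_family_on_def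
  proof (intro allI impI)
    fix h :: "nat \<Rightarrow> complex \<Rightarrow> riemann_sphere" assume "range h \<subseteq> {iter f n |n. n > 0}"
    then have "\<forall>j. \<exists>n. h j = iter f n" by fast
    from choice[OF this] obtain N where N: "\<And>j. h j = iter f (N j)" by auto
    have hF: "h j z = Fin ((f ^^ N j) z)" if "z \<in> ?S" for j z
      unfolding N using fin[OF that] by (rule iter_eq_funpow)
    define Q where "Q a b = {j. \<forall>z\<in>?S. (f ^^ N j) z \<noteq> a \<and> (f ^^ N j) z \<noteq> b}" for a b
    have "j \<in> Q a1 a2 \<union> Q a1 b2 \<union> Q b1 a2 \<union> Q b1 b2" for j
      using omit[OF pairs(1), of "N j"] omit[OF pairs(2), of "N j"] pairs(3) unfolding Q_def by auto
    then have "Q a1 a2 \<union> Q a1 b2 \<union> Q b1 a2 \<union> Q b1 b2 = UNIV" by blast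
    then have "infinite (Q a1 a2) \<or> infinite (Q a1 b2) \<or> infinite (Q b1 a2) \<or> infinite (Q b1 b2)"
      by (metis finite_Un infinite_UNIV_nat)
    then obtain a b where "infinite (Q a b)" "a \<noteq> b"
      using pairs(3) by auto
    then obtain r where r: "strict_mono (r :: nat \<Rightarrow> nat)" "\<And>n. r n \<in> Q a b"
      using infinite_enumerate by blast
    obtain s g where sg: "strict_mono (s :: nat \<Rightarrow> nat)"
      "\<And>K. compact K \<Longrightarrow> K \<subseteq> ?S \<Longrightarrow>
         uniform_limit K (\<lambda>j z. Fin ((f ^^ N (r (s j))) z)) g sequentially"
    proof -
      have 1: "(f ^^ N (r n)) holomorphic_on ?S" for n
        using iter_funpow_analytic[OF f fin] by (rule analytic_imp_holomorphic)
      have 2: "(f ^^ N (r n)) z \<noteq> a \<and> (f ^^ N (r n)) z \<noteq> b" if "z \<in> ?S" for n z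
        using r(2)[of n] that unfolding Q_def by auto
      have "w \<in> ?S" using \<open>0 < \<rho>\<close> by simp
      from omitting_sequence_normal[OF open_ball connected_ball this \<open>a \<noteq> b\<close>, of "\<lambda>n. f ^^ N (r n)", OF 1 2]
      show ?thesis using that by metis
    qed
    show "\<exists>r g. strict_mono r \<and>
         (\<forall>K. compact K \<and> K \<subseteq> ?S \<longrightarrow> uniform_limit K (\<lambda>j. h (r j)) g sequentially)"
    proof (intro exI[of _ "r \<circ> s"] exI[of _ g] conjI allI impI)
      show "strict_mono (r \<circ> s)" using r sg by (simp add: strict_mono_o)
      fix K assume K: "compact K \<and> K \<subseteq> ?S"
      have "h ((r \<circ> s) j) z = Fin ((f ^^ N (r (s j))) z)" if "z \<in> K" for j z
        using hF[of z "r (s j)"] that K by auto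
      then show "uniform_limit K (\<lambda>j. h ((r \<circ> s) j)) g sequentially"
        using sg(2)[of K] K by (simp add: uniform_limit_iff)
    qed
  qed
  moreover have "iter_defined f n x" if "x \<in> ?S" for n x
    using fin[OF that] by (simp add: iter_defined_def)
  ultimately show ?thesis
    unfolding fatou_set_def using \<open>0 < \<rho>\<close> by (auto intro!: exI[of _ ?S])
qed

lemma nicely_meromorphic_nonconstant_on_open:
  assumes f: "f nicely_meromorphic_on UNIV" and nc: "\<not> f constant_on UNIV"
    and V: "open V" "V \<noteq> {}"
  shows "\<not> f constant_on V"
proof
  assume "f constant_on V"
  then obtain c where c: "\<And>x. x \<in> V \<Longrightarrow> f x = c" by (auto simp: constant_on_def)
  obtain z where "z \<in> V" using V by auto
  have "eventually (\<lambda>x. x \<in> V) (at z)" by (rule eventually_at_in_open'[OF V(1) \<open>z \<in> V\<close>])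
  then have "eventually (\<lambda>x. f x = c) (at z)" by eventually_elim (use c in auto)
  then have "frequently (\<lambda>x. f x = c) (at z)" by (rule eventually_frequently[rotated]) simp
  from frequently_eq_meromorphic_imp_constant[OF this f] nc show False
    by (auto simp: constant_on_def)
qed

text \<open>As \<open>f\<close> is open, the image of a disc about \<open>z\<close> is a
  neighbourhood of \<open>f z\<close>, and the n-th iterate there corresponds to the iterate of
  order n + 1 on the disc.\<close>

lemma fatou_set_step:
  assumes f: "f nicely_meromorphic_on UNIV" and nc: "\<not> f constant_on UNIV"
    and z: "z \<in> fatou_set f"
  shows "f z \<in> fatou_set f"
proof -
  obtain V where V: "open V" "z \<in> V" "\<And>n w. w \<in> V \<Longrightarrow> iter f n w \<noteq> Infty"
    "normal_family_on {iter f n | n. n > 0} V"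
    using z unfolding fatou_set_def iter_defined_def by blast
  obtain \<rho> where \<rho>: "\<rho> > 0" "cball z \<rho> \<subseteq> V" using V open_contains_cball by metis
  let ?B = "cball z \<rho>" and ?W = "f ` ball z \<rho>"
  have "f analytic_on V" using iter_funpow_analytic[OF f V(3), of V 1] by simp
  then have hol: "f holomorphic_on ball z \<rho>"
    using \<rho> by (meson analytic_imp_holomorphic ball_subset_cball holomorphic_on_subset)
  have "open ?W"
    by (rule open_mapping_thm[OF hol open_ball connected_ball open_ball order_refl])
      (use nicely_meromorphic_nonconstant_on_open[OF f nc] \<rho> in auto)
  have Suc: "iter f n (f x) = iter f (Suc n) x" if "x \<in> V" for n x
  proof -
    have "iter f 1 x = Fin ((f ^^ 1) x)" using V(3)[OF that] by (rule iter_eq_funpow)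
    then show ?thesis using iter_add[of f 1 n x] by simp
  qed
  have "normal_family_on {iter f n | n. n > 0} ?W"
    unfolding normal_family_on_def
  proof (intro allI impI)
    fix h :: "nat \<Rightarrow> complex \<Rightarrow> riemann_sphere" assume "range h \<subseteq> {iter f n |n. n > 0}"
    then have "\<forall>j. \<exists>n. h j = iter f n" by fast
    from choice[OF this] obtain N where N: "\<And>j. h j = iter f (N j)" by auto
    have "range (\<lambda>j. iter f (Suc (N j))) \<subseteq> {iter f n |n. n > 0}" by blast
    from V(4)[unfolded normal_family_on_def, THEN spec, THEN mp, OF this] obtain r g where r: "strict_mono (r :: nat \<Rightarrow> nat)"
      and g: "\<And>K. compact K \<Longrightarrow> K \<subseteq> V \<Longrightarrow> uniform_limit K (\<lambda>j. iter f (Suc (N (r j)))) g sequentially"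
      by auto
    \<comment> \<open>Uniform convergence on the closed disc, which is compact in \<open>V\<close>,
      carries over along any choice of preimages, continuous or not.\<close>
    define v where "v y = (SOME x. x \<in> ?B \<and> f x = y)" for y
    have v: "v y \<in> ?B" "f (v y) = y" if "y \<in> ?W" for y
    proof -
      have "\<exists>x. x \<in> ?B \<and> f x = y" using that ball_subset_cball[of z \<rho>] by (metis imageE subsetD)
      from someI_ex[OF this] show "v y \<in> ?B" "f (v y) = y" unfolding v_def by blast+
    qed
    have "uniform_limit K (\<lambda>j. h (r j)) (\<lambda>y. g (v y)) sequentially" if K: "K \<subseteq> ?W" for K
    proof -
      have "uniform_limit K (\<lambda>j x. iter f (Suc (N (r j))) (v x)) (\<lambda>x. g (v x)) sequentially"
        by (rule uniform_limit_compose'[OF g[OF compact_cball \<rho>(2)]]) (use v K in auto)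
      moreover have "h (r j) y = iter f (Suc (N (r j))) (v y)" if "y \<in> K" for j y
        unfolding N using Suc[of "v y" "N (r j)"] v[of y] K that \<rho>(2) by (metis subsetD)
      ultimately show ?thesis by (simp add: uniform_limit_iff del: iter.simps)
    qed
    then show "\<exists>r g. strict_mono r \<and>
         (\<forall>K. compact K \<and> K \<subseteq> ?W \<longrightarrow> uniform_limit K (\<lambda>j. h (r j)) g sequentially)"
      using r by (intro exI[of _ r] exI[of _ "\<lambda>y. g (v y)"]) auto
  qed
  moreover have "iter_defined f n y" if "y \<in> ?W" for n y
  proof -
    obtain x where x: "x \<in> ball z \<rho>" "y = f x" using \<open>y \<in> ?W\<close> by auto
    then have xV: "x \<in> V" using \<rho> by auto
    show ?thesis
      unfolding iter_defined_def x(2) Suc[OF xV] using V(3)[OF xV] by blast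
  qed
  moreover have "f z \<in> ?W" using \<rho> by auto
  ultimately show ?thesis
    unfolding fatou_set_def using \<open>open ?W\<close> by (intro CollectI exI[of _ ?W]) auto
qed

lemma fatou_set_funpow:
  assumes "f nicely_meromorphic_on UNIV" "\<not> f constant_on UNIV" "z \<in> fatou_set f"
  shows "(f ^^ n) z \<in> fatou_set f"
  using assms by (induction n) (auto intro: fatou_set_step)

section \<open>Points with equal images\<close>

lemma not_pole_nhd:
  assumes f: "f nicely_meromorphic_on UNIV" and a: "\<not> is_pole f a"
  obtains r where "r > 0" "f holomorphic_on ball a r" "\<And>x. x \<in> ball a r \<Longrightarrow> \<not> is_pole f x"
proof -
  have "f analytic_on {a}" using nicely_meromorphic_on_imp_analytic_at[OF f _ a] by simp
  then obtain r where r: "r > 0" "f holomorphic_on ball a r" by (auto simp: analytic_on_def)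
  have "\<not> is_pole f x" if "x \<in> ball a r" for x
    using not_is_pole_holomorphic[OF open_ball that r(2)] .
  with r that show ?thesis by blast
qed

text \<open>For injective \<open>f\<close> the values near \<open>f a\<close> are used up by a disc
  about \<open>a\<close>. Outside it \<open>1 / (f - f a)\<close>, set to 0 at the poles, is
  holomorphic and bounded, hence extends over infinity, and \<open>f\<close> would have a limit in
  the sphere.\<close>

lemma essential_not_injective:
  assumes f: "f nicely_meromorphic_on UNIV" and ess: "essential_at_infinity f"
    and a: "\<not> is_pole f a"
  shows "\<exists>x y. x \<noteq> y \<and> \<not> is_pole f x \<and> \<not> is_pole f y \<and> f x = f y"
proof (rule ccontr)
  assume "\<not> ?thesis"
  then have inj: "x = y" if "\<not> is_pole f x" "\<not> is_pole f y" "f x = f y" for x y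
    using that by blast
  obtain r where r: "r > 0" "f holomorphic_on ball a r" "\<And>x. x \<in> ball a r \<Longrightarrow> \<not> is_pole f x"
    using not_pole_nhd[OF f a] by blast
  define c where "c = f a"
  have "inj_on f (ball a r)" using inj r(3) by (auto simp: inj_on_def)
  then have "open (f ` ball a r)" using open_mapping_thm3[OF r(2)] by auto
  moreover have "c \<in> f ` ball a r" using r(1) by (auto simp: c_def)
  ultimately obtain \<rho> where \<rho>: "\<rho> > 0" "ball c \<rho> \<subseteq> f ` ball a r"
    using open_contains_ball by blast
  have far: "cmod (f z - c) \<ge> \<rho>" if z: "z \<notin> ball a r" "\<not> is_pole f z" for z
  proof (rule ccontr)
    assume "\<not> ?thesis"
    then have "f z \<in> ball c \<rho>" by (simp add: dist_norm norm_minus_commute)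
    then obtain x where "x \<in> ball a r" "f z = f x" using \<rho> by blast
    then show False using inj[of z x] z r(3) by auto
  qed
  define k where "k z = (if is_pole f z then 0 else 1 / (f z - c))" for z
  have nz: "f z - c \<noteq> 0" if "z \<notin> ball a r" "\<not> is_pole f z" for z
    using far[OF that] \<rho> by auto
  have kan: "k analytic_on {z}" if z: "z \<in> - cball a r" for z
  proof (cases "is_pole f z")
    case False
    obtain s where s: "s > 0" "f holomorphic_on ball z s" "\<And>x. x \<in> ball z s \<Longrightarrow> \<not> is_pole f x"
      using not_pole_nhd[OF f False] by blast
    define W where "W = ball z s \<inter> - cball a r"
    have "(\<lambda>x. 1 / (f x - c)) holomorphic_on W"
      using nz s by (intro holomorphic_intros) (auto simp: W_def intro: holomorphic_on_subset)
    then have "k holomorphic_on W"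
      by (rule holomorphic_transform) (use s in \<open>auto simp: k_def W_def\<close>)
    moreover have "open W" "z \<in> W" using z s by (auto simp: W_def open_Compl)
    ultimately show ?thesis using analytic_at by blast
  next
    case True
    have "isolated_singularity_at f z"
      using f by (meson UNIV_I meromorphic_on_isolated_singularity meromorphic_on_meromorphic_at nicely_meromorphic_on_def)
    then obtain s where s: "s > 0" "f analytic_on ball z s - {z}"
      unfolding isolated_singularity_at_def by blast
    have np: "\<not> is_pole f x" if "x \<in> ball z s - {z}" for x
      by (rule not_is_pole_holomorphic[of "ball z s - {z}"]) (use that s in \<open>auto simp: analytic_imp_holomorphic open_delete\<close>)
    define W where "W = ball z s \<inter> - cball a r"
    have "open W" "z \<in> W" using z s by (auto simp: W_def open_Compl)
    have "(\<lambda>x. if x = z then 0 else inverse (f x - c)) holomorphic_on W"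
    proof (rule is_pole_inverse_holomorphic[OF \<open>open W\<close>])
      have "f holomorphic_on W - {z}"
        using s(2) by (rule holomorphic_on_subset[OF analytic_imp_holomorphic]) (auto simp: W_def)
      then show "(\<lambda>x. f x - c) holomorphic_on W - {z}" by (intro holomorphic_intros)
      show "is_pole (\<lambda>x. f x - c) z" using True is_pole_plus_const_iff[of f z "- c"] by simp
      show "\<forall>x\<in>W - {z}. f x - c \<noteq> 0" using nz np by (auto simp: W_def)
    qed
    then have "k holomorphic_on W"
      by (rule holomorphic_transform) (use np True in \<open>auto simp: k_def W_def inverse_eq_divide\<close>)
    then show ?thesis using \<open>open W\<close> \<open>z \<in> W\<close> analytic_at by blast
  qed
  \<comment> \<open>Large enough that 1/x lies outside \<open>cball a r\<close> whenever 0 < |x| <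
    1/M; the point 0 then stands for infinity.\<close>
  define M where "M = cmod a + r + 1"
  have M: "M > 0" using r by (simp add: M_def add_nonneg_pos)
  have big: "1 / x \<in> - cball a r" if "x \<in> ball 0 (1 / M) - {0}" for x
  proof -
    have "M < cmod (1 / x)" using that M by (auto simp: norm_divide field_simps)
    then show ?thesis using norm_triangle_sub[of "1 / x" a] by (auto simp: dist_norm norm_minus_commute M_def)
  qed
  have "k analytic_on - cball a r" using kan analytic_on_analytic_at by blast
  then have "k holomorphic_on - cball a r" by (rule analytic_imp_holomorphic)
  moreover have "(\<lambda>x. 1 / x) holomorphic_on ball 0 (1 / M) - {0}"
    by (intro holomorphic_intros) auto
  moreover have "(\<lambda>x. 1 / x) ` (ball 0 (1 / M) - {0}) \<subseteq> - cball a r"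
    using big by (rule image_subsetI)
  ultimately have "(\<lambda>x. k (1 / x)) holomorphic_on ball 0 (1 / M) - {0}"
    using holomorphic_on_compose_gen[of "\<lambda>x. 1 / x" _ k] by (simp only: o_def)
  moreover have "eventually (\<lambda>x. cmod (k (1 / x)) \<le> 1 / \<rho>) (at 0)"
  proof -
    have "eventually (\<lambda>x. x \<in> ball 0 (1 / M) - {0}) (at (0::complex))"
      using M by (intro eventually_at_in_open) auto
    then show ?thesis
    proof eventually_elim
      case (elim x)
      have "1 / x \<notin> ball a r" using big[OF elim] by auto
      then show ?case using far[of "1 / x"] \<rho> by (auto simp: k_def norm_divide intro: frac_le)
    qed
  qed
  moreover have "(0::complex) \<in> interior (ball 0 (1 / M))" using M by simp
  ultimately obtain g where g: "g holomorphic_on ball 0 (1 / M)" "\<And>x. x \<in> ball 0 (1 / M) - {0} \<Longrightarrow> g x = k (1 / x)"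
    using holomorphic_on_extend_bounded[of "\<lambda>x. k (1 / x)" "ball 0 (1 / M)" 0] by blast
  \<comment> \<open>\<open>T\<close> undoes \<open>k\<close> and sends its zeros, the poles of
    \<open>f\<close>, to \<open>Infty\<close>.\<close>
  define T where "T x = (if x = 0 then Infty else Fin (c + 1 / x))" for x
  have T: "continuous_on UNIV T"
    unfolding T_def[abs_def] by (rule continuous_on_shifted_inversion)
  have "(g \<longlongrightarrow> g 0) (at 0)"
    using g(1) M by (metis centre_in_ball continuous_on_eq_continuous_at holomorphic_on_imp_continuous_on
        isCont_def open_ball zero_less_divide_1_iff)
  then have "((\<lambda>x. g (1 / x)) \<longlongrightarrow> g 0) at_infinity"
    using filterlim_compose[OF _ filterlim_inverse_at_iff[THEN iffD2, OF filterlim_ident]] by (simp add: inverse_eq_divide)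
  then have "((\<lambda>x. T (g (1 / x))) \<longlongrightarrow> T (g 0)) at_infinity"
    using T by (intro isCont_tendsto_compose[of _ T]) (auto simp: continuous_on_eq_continuous_at)
  moreover have "eventually (\<lambda>z. T (g (1 / z)) = sphere_map f z) at_infinity"
    unfolding eventually_at_infinity
  proof (intro exI[of _ "M + 1"] allI impI)
    fix z assume "M + 1 \<le> cmod z"
    then have "M < cmod z" "z \<noteq> 0" using M by auto
    then have z: "1 / z \<in> ball 0 (1 / M) - {0}" using M by (simp add: norm_divide frac_less2)
    have "z \<notin> ball a r" using big[OF z] by auto
    then show "T (g (1 / z)) = sphere_map f z"
      using g(2)[OF z] nz[of z] by (auto simp: T_def k_def sphere_map_def)
  qed
  ultimately have "(sphere_map f \<longlongrightarrow> T (g 0)) at_infinity"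
    using tendsto_cong by force
  then show False using ess by (auto simp: essential_at_infinity_def)
qed

lemma essential_nonconstant:
  assumes "essential_at_infinity f"
  shows "\<not> f constant_on UNIV"
proof
  assume "f constant_on UNIV"
  then obtain c where c: "f = (\<lambda>_. c)" by (auto simp: constant_on_def)
  then have "\<not> is_pole f z" for z by (simp add: c)
  then have "sphere_map f = (\<lambda>_. Fin c)" by (auto simp: sphere_map_def c)
  then show False using assms by (auto simp: essential_at_infinity_def)
qed

text \<open>A second pair lies near the first: disjoint discs about \<open>x\<close> and
  \<open>y\<close> have open images containing the common value, so these images share a further
  value. Disjointness and the new value keep the four points distinct.\<close>

lemma essential_two_pairs:
  assumes f: "f nicely_meromorphic_on UNIV" and ess: "essential_at_infinity f"
    and a: "\<not> is_pole f a"
  obtains a1 b1 a2 b2 where "f a1 = f b1" "f a2 = f b2" "distinct [a1, b1, a2, b2]"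
    "\<And>x. x \<in> {a1, b1, a2, b2} \<Longrightarrow> \<not> is_pole f x"
proof -
  obtain x y where xy: "x \<noteq> y" "\<not> is_pole f x" "\<not> is_pole f y" "f x = f y"
    using essential_not_injective[OF assms] by blast
  have nc: "\<not> f constant_on ball z r" if "r > 0" for z r
    using nicely_meromorphic_nonconstant_on_open[OF f essential_nonconstant[OF ess]] that by simp
  obtain r where r: "r > 0" "f holomorphic_on ball x r" "\<And>u. u \<in> ball x r \<Longrightarrow> \<not> is_pole f u"
    using not_pole_nhd[OF f xy(2)] by blast
  obtain s where s: "s > 0" "f holomorphic_on ball y s" "\<And>u. u \<in> ball y s \<Longrightarrow> \<not> is_pole f u"
    using not_pole_nhd[OF f xy(3)] by blast
  define d where "d = dist x y / 2"
  define A where "A = ball x (min r d)"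
  define B where "B = ball y (min s d)"
  have d: "d > 0" using xy by (simp add: d_def)
  have disj: "A \<inter> B = {}"
    using dist_triangle_less_add[of x _ d y d] by (auto simp: A_def B_def d_def dist_commute)
  have "open (f ` A)" unfolding A_def
    by (rule open_mapping_thm[OF _ open_ball connected_ball open_ball order_refl])
      (use nc r d in \<open>auto intro: holomorphic_on_subset\<close>)
  moreover have "open (f ` B)" unfolding B_def
    by (rule open_mapping_thm[OF _ open_ball connected_ball open_ball order_refl])
      (use nc s d in \<open>auto intro: holomorphic_on_subset\<close>)
  ultimately have "open (f ` A \<inter> f ` B)" by (rule open_Int)
  moreover have "f x \<in> f ` A \<inter> f ` B"
    using r s d imageI[of x A f] imageI[of y B f] unfolding xy(4) by (auto simp: A_def B_def)
  ultimately have "infinite (f ` A \<inter> f ` B)" using finite_imp_not_open by blast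
  then obtain v where v: "v \<in> f ` A \<inter> f ` B" "v \<noteq> f x"
    using \<open>f x \<in> f ` A \<inter> f ` B\<close> by (metis finite.simps finite_insert insert_iff subsetI finite_subset)
  then obtain a2 b2 where 2: "a2 \<in> A" "b2 \<in> B" "f a2 = v" "f b2 = v" by auto
  have "x \<in> A" "y \<in> B" using r s d by (auto simp: A_def B_def)
  show ?thesis
  proof (rule that[of x y a2 b2])
    show "distinct [x, y, a2, b2]"
      using disj 2 \<open>x \<in> A\<close> \<open>y \<in> B\<close> v(2) xy by auto
    show "\<not> is_pole f u" if "u \<in> {x, y, a2, b2}" for u
      using that xy 2 r s by (auto simp: A_def B_def)
  qed (use xy 2 in auto)
qed

text \<open>Off the critical values \<open>f\<close> is injective near \<open>g1 x\<close>, so the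
  lifts agree near \<open>x\<close>; the identity theorem spreads this over
  \<open>A\<close>.\<close>

lemma lift_unique:
  assumes f: "f nicely_meromorphic_on UNIV" and A: "open A" "connected A"
    and g: "g1 holomorphic_on A" "g2 holomorphic_on A"
    and lift: "\<And>s. s \<in> A \<Longrightarrow> f (g1 s) = h s" "\<And>s. s \<in> A \<Longrightarrow> f (g2 s) = h s"
    and np: "\<And>s. s \<in> A \<Longrightarrow> \<not> is_pole f (g1 s)"
    and crit: "\<And>s. s \<in> A \<Longrightarrow> h s \<notin> critical_values f"
    and x: "x \<in> A" "g1 x = g2 x" and y: "y \<in> A"
  shows "g1 y = g2 y"
proof -
  have dnz: "deriv f (g1 x) \<noteq> 0"
    using crit[OF x(1)] np[OF x(1)] unfolding lift(1)[OF x(1), symmetric] critical_values_def by blast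
  obtain r0 where r0: "r0 > 0" "f holomorphic_on ball (g1 x) r0"
    using not_pole_nhd[OF f np[OF x(1)]] by metis
  obtain r where r: "r > 0" "inj_on f (ball (g1 x) r)"
    using has_complex_derivative_locally_injective[OF r0(2) _ open_ball dnz] r0(1) by auto
  have "open (A \<inter> g1 -` ball (g1 x) r)" "open (A \<inter> g2 -` ball (g1 x) r)"
    using A(1) g by (auto intro!: continuous_open_preimage holomorphic_on_imp_continuous_on)
  then have op: "open (A \<inter> g1 -` ball (g1 x) r \<inter> (A \<inter> g2 -` ball (g1 x) r))" (is "open ?V") by auto
  have xV: "x \<in> ?V" using x r by auto
  have "g1 z - g2 z = 0" if "z \<in> ?V" for z
    using that lift[of z] inj_onD[OF r(2), of "g1 z" "g2 z"] by auto
  then have "g1 y - g2 y = 0"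
    using analytic_continuation_open[OF op A(1) _ A(2), of "\<lambda>z. g1 z - g2 z" "\<lambda>_. 0" y] xV y
      holomorphic_on_diff[OF g] by fastforce
  then show ?thesis by simp
qed

section \<open>Lifting through a meromorphic map\<close>

text \<open>Poles are excluded explicitly because the equation alone could hold there through the
  dummy value 0 of \<open>f\<close>.\<close>

definition lift_on :: "(complex \<Rightarrow> complex) \<Rightarrow> (complex \<Rightarrow> complex) \<Rightarrow> complex set \<Rightarrow> (complex \<Rightarrow> complex) \<Rightarrow> bool" where
  "lift_on f h A g \<longleftrightarrow> g holomorphic_on A \<and> (\<forall>s\<in>A. \<not> is_pole f (g s) \<and> f (g s) = h s)"

lemma lift_on_subset: "lift_on f h A g \<Longrightarrow> B \<subseteq> A \<Longrightarrow> lift_on f h B g"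
  by (auto simp: lift_on_def intro: holomorphic_on_subset)

lemma lift_on_agree:
  assumes "f nicely_meromorphic_on UNIV" "open A" "connected A" "lift_on f h A g1" "lift_on f h A g2"
    and "h ` A \<inter> critical_values f = {}" "x \<in> A" "g1 x = g2 x" "y \<in> A"
  shows "g1 y = g2 y"
  using assms lift_unique[of f A g1 g2 h x y] unfolding lift_on_def by blast

text \<open>Convexity makes the overlap connected, so agreement at one point is agreement on all of
  it.\<close>

lemma lift_on_glue:
  assumes f: "f nicely_meromorphic_on UNIV" and A: "open A" "convex A" and B: "open B" "convex B"
    and g: "lift_on f h A g1" "lift_on f h B g2"
    and crit: "h ` A \<inter> critical_values f = {}"
    and x: "x \<in> A" "x \<in> B" "g1 x = g2 x"
  shows "lift_on f h (A \<union> B) (\<lambda>s. if s \<in> A then g1 s else g2 s)"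
proof -
  have eq: "g1 y = g2 y" if "y \<in> A \<inter> B" for y
    by (rule lift_on_agree[OF f _ _ lift_on_subset[OF g(1)] lift_on_subset[OF g(2)], of "A \<inter> B" x y])
      (use A B x crit that in \<open>auto intro: convex_connected convex_Int\<close>)
  have 1: "(\<lambda>s. if s \<in> A then g1 s else g2 s) holomorphic_on A"
    by (rule holomorphic_transform[of g1]) (use g in \<open>auto simp: lift_on_def\<close>)
  have 2: "(\<lambda>s. if s \<in> A then g1 s else g2 s) holomorphic_on B"
    by (rule holomorphic_transform[of g2]) (use g eq in \<open>auto simp: lift_on_def\<close>)
  show ?thesis
    using holomorphic_on_Un[OF 1 2 A(1) B(1)] g unfolding lift_on_def by auto
qed

text \<open>The lift is \<open>h\<close> followed by a local inverse of \<open>f\<close> at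
  \<open>c\<close>. The last clause serves to identify it later with a lift of which only closeness
  to \<open>c\<close> at one point is known.\<close>

lemma local_lift:
  assumes f: "f nicely_meromorphic_on UNIV" and h: "h holomorphic_on R" "open R" "s \<in> R"
    and c: "\<not> is_pole f c" "f c = h s" and crit: "h s \<notin> critical_values f"
  obtains \<delta> r g where "\<delta> > 0" "ball s \<delta> \<subseteq> R" "r > 0" "lift_on f h (ball s \<delta>) g"
    "\<And>x y. x \<in> ball s \<delta> \<Longrightarrow> y \<in> ball c r \<Longrightarrow> f y = h x \<Longrightarrow> g x = y"
proof -
  have dnz: "deriv f c \<noteq> 0" using crit c(1) unfolding c(2)[symmetric] critical_values_def by blast
  obtain r0 where r0: "r0 > 0" "f holomorphic_on ball c r0" "\<And>x. x \<in> ball c r0 \<Longrightarrow> \<not> is_pole f x"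
    using not_pole_nhd[OF f c(1)] by metis
  obtain r where r: "r > 0" "ball c r \<subseteq> ball c r0" "inj_on f (ball c r)"
    using has_complex_derivative_locally_injective[OF r0(2) _ open_ball dnz] r0(1)
    by (metis centre_in_ball)
  have hol: "f holomorphic_on ball c r" using r0(2) r(2) by (rule holomorphic_on_subset)
  obtain \<phi> where \<phi>: "\<phi> holomorphic_on f ` ball c r" "\<And>z. z \<in> ball c r \<Longrightarrow> \<phi> (f z) = z"
    using holomorphic_has_inverse[OF hol open_ball r(3)] by metis
  have "open (f ` ball c r)" by (rule open_mapping_thm3[OF hol open_ball r(3)])
  then have "open (R \<inter> h -` (f ` ball c r))"
    by (intro continuous_open_preimage h holomorphic_on_imp_continuous_on)
  moreover have "s \<in> R \<inter> h -` (f ` ball c r)" using h r(1) c(2)[symmetric] by auto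
  ultimately obtain \<delta> where \<delta>: "\<delta> > 0" "ball s \<delta> \<subseteq> R \<inter> h -` (f ` ball c r)"
    using open_contains_ball by metis
  have "h holomorphic_on ball s \<delta>" using h(1) \<delta>(2) by (meson Int_subset_iff holomorphic_on_subset)
  moreover have "h ` ball s \<delta> \<subseteq> f ` ball c r" using \<delta>(2) by blast
  ultimately have hol': "(\<lambda>x. \<phi> (h x)) holomorphic_on ball s \<delta>"
    using holomorphic_on_compose_gen[OF _ \<phi>(1), of h "ball s \<delta>"] by (simp only: o_def)
  have inv: "\<phi> (h x) \<in> ball c r \<and> f (\<phi> (h x)) = h x" if x: "x \<in> ball s \<delta>" for x
  proof -
    obtain y where "y \<in> ball c r" "h x = f y" using x \<delta>(2) by blast
    then show ?thesis using \<phi>(2) by auto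
  qed
  show ?thesis
  proof (rule that[OF \<delta>(1) _ r(1), of "\<lambda>x. \<phi> (h x)"])
    show "lift_on f h (ball s \<delta>) (\<lambda>x. \<phi> (h x))"
      using hol' inv r0(3) r(2) unfolding lift_on_def by blast
    show "\<phi> (h x) = y" if "x \<in> ball s \<delta>" "y \<in> ball c r" "f y = h x" for x y
      using \<phi>(2)[OF that(2)] that(3) by simp
  qed (use \<delta>(2) in blast)
qed

text \<open>If a lift along a curve ran off to infinity, the endpoint of the curve would be an asymptotic
  value.\<close>

lemma lifted_path_accumulates:
  fixes \<gamma> \<sigma> :: "real \<Rightarrow> complex"
  assumes f: "f nicely_meromorphic_on UNIV" and T: "0 < T"
    and cont: "continuous_on {0..<T} \<gamma>"
    and lift: "\<And>t. t \<in> {0..<T} \<Longrightarrow> \<not> is_pole f (\<gamma> t) \<and> f (\<gamma> t) = \<sigma> t"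
    and \<sigma>: "(\<sigma> \<longlongrightarrow> v) (at_left T)" and v: "v \<notin> asymptotic_values f"
  obtains c where "\<not> is_pole f c" "f c = v"
    "\<And>e d. 0 < e \<Longrightarrow> d < T \<Longrightarrow> \<exists>t. d < t \<and> t \<in> {0..<T} \<and> \<gamma> t \<in> ball c e"
proof -
  have notinf: "\<not> filterlim \<gamma> at_infinity (at_left T)"
  proof
    assume inf: "filterlim \<gamma> at_infinity (at_left T)"
    \<comment> \<open>Stretches \<open>{0..<T}\<close> to a half-line, since asymptotic values are
      defined by curves on \<open>{0..}\<close>.\<close>
    define \<tau> where "\<tau> x = T - T / (x + 1)" for x
    have \<tau>: "\<tau> x \<in> {0..<T}" if "x \<ge> 0" for x
      using T that by (auto simp: \<tau>_def field_simps)
    have lim: "filterlim \<tau> (at_left T) at_top"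
      unfolding \<tau>_def using T by real_asymp
    have "continuous_on {0..} (\<lambda>x. \<gamma> (\<tau> x))"
      by (rule continuous_on_compose2[OF cont])
        (use \<tau> in \<open>auto simp: \<tau>_def[abs_def] intro!: continuous_intros\<close>)
    moreover have "filterlim (\<lambda>x. \<gamma> (\<tau> x)) at_infinity at_top"
      by (rule filterlim_compose[OF inf lim])
    moreover have "((\<lambda>x. sphere_map f (\<gamma> (\<tau> x))) \<longlongrightarrow> Fin v) at_top"
    proof -
      have "isCont Fin v"
        using continuous_on_Fin[of UNIV] by (simp add: continuous_on_eq_continuous_at)
      then have "((\<lambda>x. Fin (\<sigma> (\<tau> x))) \<longlongrightarrow> Fin v) at_top"
        by (rule isCont_tendsto_compose[OF _ filterlim_compose[OF \<sigma> lim]])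
      moreover have "eventually (\<lambda>x. Fin (\<sigma> (\<tau> x)) = sphere_map f (\<gamma> (\<tau> x))) at_top"
        using eventually_ge_at_top[of 0]
        by eventually_elim (use lift[OF \<tau>] in \<open>simp add: sphere_map_def\<close>)
      ultimately show ?thesis by (rule Lim_transform_eventually)
    qed
    ultimately show False using v unfolding asymptotic_values_def by blast
  qed
  \<comment> \<open>Failing to tend to infinity gives a bound only at some times arbitrarily near
    \<open>T\<close>; these supply a sequence of values with an accumulation point
    \<open>c\<close>.\<close>
  then obtain B where "\<not> eventually (\<lambda>t. B \<le> cmod (\<gamma> t)) (at_left T)"
    unfolding filterlim_at_infinity[OF order_refl] by blast
  then have freq: "\<exists>t\<in>{0..<T}. T - 1 / Suc n < t \<and> cmod (\<gamma> t) \<le> B" for n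
  proof (rule contrapos_np)
    assume neg: "\<not> (\<exists>t\<in>{0..<T}. T - 1 / Suc n < t \<and> cmod (\<gamma> t) \<le> B)"
    have "eventually (\<lambda>t. t \<in> {max 0 (T - 1 / Suc n)<..<T}) (at_left T)"
      using T by (intro eventually_at_left_real) auto
    then show "eventually (\<lambda>t. B \<le> cmod (\<gamma> t)) (at_left T)"
      by eventually_elim (use neg in force)
  qed
  then obtain t where t: "\<And>n. t n \<in> {0..<T}" "\<And>n. T - 1 / Suc n < t n" "\<And>n. cmod (\<gamma> (t n)) \<le> B"
    by metis
  have "seq_compact (cball (0::complex) B)" by (rule compact_imp_seq_compact[OF compact_cball])
  moreover have "\<forall>n. \<gamma> (t n) \<in> cball 0 B" using t(3) by simp
  ultimately obtain c r where c: "strict_mono (r :: nat \<Rightarrow> nat)" "((\<lambda>n. \<gamma> (t (r n))) \<longlonglongrightarrow> c)"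
    by (rule seq_compactE) (simp add: o_def)
  have tT: "t \<longlonglongrightarrow> T"
  proof (rule real_tendsto_sandwich)
    show "(\<lambda>n. T - 1 / Suc n) \<longlonglongrightarrow> T" by real_asymp
    show "eventually (\<lambda>n. T - 1 / Suc n \<le> t n) sequentially" using t(2) by (simp add: less_imp_le)
    show "eventually (\<lambda>n. t n \<le> T) sequentially" using t(1) by (simp add: less_imp_le)
  qed auto
  have trT: "(\<lambda>n. t (r n)) \<longlonglongrightarrow> T" using LIMSEQ_subseq_LIMSEQ[OF tT c(1)] by (simp add: o_def)
  have "filterlim (\<lambda>n. t (r n)) (at_left T) sequentially"
    using trT t(1) by (intro tendsto_imp_filterlim_at_left) (auto intro!: always_eventually)
  from filterlim_compose[OF \<sigma> this] have lim: "(\<lambda>n. f (\<gamma> (t (r n)))) \<longlonglongrightarrow> v"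
    using lift t(1) by simp
  \<comment> \<open>At a pole \<open>f\<close> would tend to infinity along the sequence, while its
    values there are those of \<sigma> and converge to \<open>v\<close>.\<close>
  have np: "\<not> is_pole f c"
  proof
    assume p: "is_pole f c"
    have "\<gamma> (t (r n)) \<noteq> c" for n using lift[OF t(1), of "r n"] p by auto
    then have "filterlim (\<lambda>n. \<gamma> (t (r n))) (at c) sequentially"
      using c(2) by (simp add: filterlim_at)
    from filterlim_compose[OF p[unfolded is_pole_def] this]
    have "filterlim (\<lambda>n. f (\<gamma> (t (r n)))) at_infinity sequentially" .
    then show False
      using lim not_tendsto_and_filterlim_at_infinity trivial_limit_sequentially by blast
  qed
  have "isCont f c"
    using nicely_meromorphic_on_imp_analytic_at[OF f _ np] by (simp add: analytic_at_imp_isCont)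
  then have "(\<lambda>n. f (\<gamma> (t (r n)))) \<longlonglongrightarrow> f c" by (rule isCont_tendsto_compose[OF _ c(2)])
  then have "f c = v" using lim by (rule LIMSEQ_unique)
  show ?thesis
  proof (rule that[OF np \<open>f c = v\<close>])
    fix e d :: real assume "0 < e" "d < T"
    have "eventually (\<lambda>n. dist (\<gamma> (t (r n))) c < e) sequentially" using c(2) \<open>0 < e\<close> by (rule tendstoD)
    moreover have "eventually (\<lambda>n. d < t (r n)) sequentially" using trT \<open>d < T\<close> by (rule order_tendstoD)
    ultimately have "eventually (\<lambda>n. dist (\<gamma> (t (r n))) c < e \<and> d < t (r n)) sequentially"
      by (rule eventually_conj)
    from eventually_happens'[OF sequentially_bot this]
    obtain n where "dist (\<gamma> (t (r n))) c < e" "d < t (r n)" by blast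
    then show "\<exists>t. d < t \<and> t \<in> {0..<T} \<and> \<gamma> t \<in> ball c e"
      using t(1)[of "r n"] by (auto simp: dist_commute)
  qed
qed

text \<open>All domains contain the base point \<open>s0\<close>, and convexity makes their pairwise
  overlaps connected, so lifts with the common value \<open>a\<close> at \<open>s0\<close> are
  compatible.\<close>

lemma lift_on_Union:
  assumes f: "f nicely_meromorphic_on UNIV"
    and W: "\<And>i. i \<in> I \<Longrightarrow> open (W i) \<and> convex (W i) \<and> s0 \<in> W i \<and> lift_on f h (W i) (g i) \<and> g i s0 = a"
    and crit: "\<And>i. i \<in> I \<Longrightarrow> h ` W i \<inter> critical_values f = {}"
  obtains G where "lift_on f h (\<Union>i\<in>I. W i) G" "\<And>i s. i \<in> I \<Longrightarrow> s \<in> W i \<Longrightarrow> G s = g i s"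
proof -
  have agree: "g i s = g j s" if "i \<in> I" "j \<in> I" "s \<in> W i" "s \<in> W j" for i j s
  proof (rule lift_on_agree[OF f, of "W i \<inter> W j" h "g i" "g j" s0 s])
    show "open (W i \<inter> W j)" "connected (W i \<inter> W j)"
      using W that by (auto intro!: convex_connected convex_Int)
    show "lift_on f h (W i \<inter> W j) (g i)" "lift_on f h (W i \<inter> W j) (g j)"
      using W that by (meson lift_on_subset inf_le1 inf_le2)+
  qed (use W that crit in \<open>auto; fastforce\<close>)+
  define k where "k s = (SOME i. i \<in> I \<and> s \<in> W i)" for s
  have k: "k s \<in> I \<and> s \<in> W (k s)" if "i \<in> I" "s \<in> W i" for i s
    unfolding k_def by (rule someI[of "\<lambda>i. i \<in> I \<and> s \<in> W i" i]) (use that in auto)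
  define G where "G s = g (k s) s" for s
  have G: "G s = g i s" if "i \<in> I" "s \<in> W i" for i s
    unfolding G_def using agree k[OF that] that by blast
  have hol: "G holomorphic_on W i" if i: "i \<in> I" for i
  proof (rule holomorphic_transform[of "g i"])
    show "g i holomorphic_on W i" using W[OF i] by (simp add: lift_on_def)
    show "g i x = G x" if "x \<in> W i" for x using G[OF i that] by simp
  qed
  have "lift_on f h (\<Union>i\<in>I. W i) G"
    unfolding lift_on_def
  proof (intro conjI ballI)
    show "G holomorphic_on (\<Union>i\<in>I. W i)"
      by (rule holomorphic_on_UN_open) (use hol W in blast)+
    fix s assume "s \<in> (\<Union>i\<in>I. W i)"
    then obtain i where i: "i \<in> I" "s \<in> W i" by blast
    then have "\<not> is_pole f (g i s) \<and> f (g i s) = h s" using W unfolding lift_on_def by blast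
    then show "\<not> is_pole f (G s)" "f (G s) = h s" using G[OF i] by simp_all
  qed
  then show ?thesis using that G by blast
qed

lemma convex_neighbourhood:
  fixes A :: "'a::real_normed_vector set"
  assumes "convex A"
  shows "convex (\<Union>x\<in>A. ball x e)"
proof -
  have "(\<Union>x\<in>A. ball x e) = (\<Union>x\<in>A. \<Union>y\<in>ball 0 e. {x + y})"
  proof (intro equalityI subsetI)
    fix z assume "z \<in> (\<Union>x\<in>A. ball x e)"
    then obtain x where "x \<in> A" "z - x \<in> ball 0 e" by (auto simp: dist_norm norm_minus_commute)
    then show "z \<in> (\<Union>x\<in>A. \<Union>y\<in>ball 0 e. {x + y})" by force
  next
    fix z assume "z \<in> (\<Union>x\<in>A. \<Union>y\<in>ball 0 e. {x + y})"
    then obtain x y where "x \<in> A" "norm y < e" "z = x + y" by auto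
    then have "x \<in> A" "z \<in> ball x e" by (simp_all add: dist_norm)
    then show "z \<in> (\<Union>x\<in>A. ball x e)" by blast
  qed
  then show ?thesis using convex_sums[OF assms convex_ball] by metis
qed

text \<open>Continuation along the segment: the times up to which a lift exists form an interval,
  open because the domains are open, and closed because the lift accumulates at a finite preimage of
  the endpoint, where a local lift takes over.\<close>

lemma lift_along_segment:
  assumes f: "f nicely_meromorphic_on UNIV" and R: "open R" "convex R"
    and h: "h holomorphic_on R" "h ` R \<inter> singular_values f = {}"
    and s: "s0 \<in> R" "s1 \<in> R" and a: "\<not> is_pole f a" "f a = h s0"
  obtains W g where "open W" "convex W" "s0 \<in> W" "s1 \<in> W" "W \<subseteq> R" "lift_on f h W g" "g s0 = a"
proof -
  define pt where "pt t = s0 + of_real t * (s1 - s0)" for t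
  have pt01: "pt 0 = s0" "pt 1 = s1" by (auto simp: pt_def)
  have ptc: "continuous_on A pt" for A unfolding pt_def by (intro continuous_intros)
  have pt_conv: "convex (pt ` A)" if "convex A" for A
  proof -
    have "pt ` A = (\<lambda>x. s0 + x) ` ((\<lambda>t. t *\<^sub>R (s1 - s0)) ` A)"
      by (simp add: image_image pt_def scaleR_conv_of_real)
    moreover have "linear (\<lambda>t. t *\<^sub>R (s1 - s0))" by (simp add: linear_scale_left bounded_linear.linear bounded_linear_scaleR_left)
    ultimately show ?thesis using that by (simp add: convex_linear_image convex_translation)
  qed
  have ptR: "pt t \<in> R" if "t \<in> {0..1}" for t
  proof -
    have "pt t = (1 - t) *\<^sub>R s0 + t *\<^sub>R s1" by (simp add: pt_def scaleR_conv_of_real algebra_simps)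
    then show ?thesis using convexD_alt[OF R(2) s, of t] that by simp
  qed
  have sing: "h x \<notin> critical_values f" "h x \<notin> asymptotic_values f" if "x \<in> R" for x
    using h(2) that unfolding singular_values_def by auto
  have crit: "h ` A \<inter> critical_values f = {}" if "A \<subseteq> R" for A
    using sing(1) that by auto
  \<comment> \<open>Domains are kept convex so that any two meet in a connected set and lifts with
    the same start agree there.\<close>
  define P where "P t W g \<longleftrightarrow> open W \<and> convex W \<and> pt ` {0..t} \<subseteq> W \<and> W \<subseteq> R \<and> lift_on f h W g \<and> g s0 = a"
    for t W g
  define Good where "Good t \<longleftrightarrow> (\<exists>W g. P t W g)" for t
  have good_mono: "Good t'" if "Good t" "t' \<le> t" for t t'
  proof -
    have "pt ` {0..t'} \<subseteq> pt ` {0..t}" using that(2) by (intro image_mono) auto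
    then have "P t W g \<Longrightarrow> P t' W g" for W g unfolding P_def by blast
    then show ?thesis using that(1) unfolding Good_def by blast
  qed
  have good_0: "Good 0"
  proof -
    obtain \<delta> r g where g: "\<delta> > 0" "ball s0 \<delta> \<subseteq> R" "r > 0" "lift_on f h (ball s0 \<delta>) g"
      "\<And>x y. x \<in> ball s0 \<delta> \<Longrightarrow> y \<in> ball a r \<Longrightarrow> f y = h x \<Longrightarrow> g x = y"
      using local_lift[OF f h(1) R(1) s(1) a sing(1)[OF s(1)]] by blast
    have "g s0 = a" using g(5)[of s0 a] g(1,3) a by simp
    then have "P 0 (ball s0 \<delta>) g" using g(1,2,4) by (simp add: P_def pt01)
    then show ?thesis unfolding Good_def by blast
  qed
  have good_open: "\<exists>t'>t. Good t'" if "Good t" "0 \<le> t" for t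
  proof -
    obtain W g where W: "P t W g" using \<open>Good t\<close> unfolding Good_def by blast
    have "open (pt -` W)" using W ptc open_vimage[of W pt] by (auto simp: P_def)
    moreover have "t \<in> pt -` W" using W that unfolding P_def by auto
    ultimately obtain e where e: "e > 0" "ball t e \<subseteq> pt -` W" using open_contains_ball by metis
    have "pt x \<in> W" if "x \<in> {0..t + e / 2}" for x
    proof (cases "x \<le> t")
      case True
      then show ?thesis using W that unfolding P_def by auto
    next
      case False
      then have "x \<in> ball t e" using that e(1) by (simp add: dist_real_def)
      then show ?thesis using e(2) by blast
    qed
    then have "P (t + e / 2) W g" using W unfolding P_def by blast
    then show ?thesis using e(1) unfolding Good_def by (intro exI[of _ "t + e / 2"]) auto
  qed
  have good_closed: "Good T" if T: "0 < T" "T \<le> 1" and good: "\<And>t. 0 \<le> t \<Longrightarrow> t < T \<Longrightarrow> Good t" for T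
  proof -
    have "\<forall>t\<in>{0..<T}. \<exists>W. \<exists>g. P t W g" using good unfolding Good_def by auto
    from bchoice[OF this] obtain W where "\<forall>t\<in>{0..<T}. \<exists>g. P t (W t) g" ..
    from bchoice[OF this] obtain g where Wg: "\<forall>t\<in>{0..<T}. P t (W t) (g t)" ..
    have ptW: "pt u \<in> W t" if "t \<in> {0..<T}" "u \<in> {0..t}" for t u
      using Wg that unfolding P_def by blast
    have W0: "open (W i) \<and> convex (W i) \<and> s0 \<in> W i \<and> lift_on f h (W i) (g i) \<and> g i s0 = a" if "i \<in> {0..<T}" for i
      using Wg that ptW[OF that, of 0] unfolding P_def pt01 by auto
    obtain G where G: "lift_on f h (\<Union>t\<in>{0..<T}. W t) G" "\<And>t s. t \<in> {0..<T} \<Longrightarrow> s \<in> W t \<Longrightarrow> G s = g t s"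
    proof (rule lift_on_Union[OF f, of "{0..<T}" W s0 h g a])
      show "h ` W i \<inter> critical_values f = {}" if "i \<in> {0..<T}" for i
        using Wg that crit unfolding P_def by blast
    qed (use W0 in blast)+
    have cG: "continuous_on {0..<T} (\<lambda>t. G (pt t))"
    proof (rule continuous_on_compose2[OF _ ptc])
      show "continuous_on (\<Union>t\<in>{0..<T}. W t) G"
        using G(1) unfolding lift_on_def by (intro holomorphic_on_imp_continuous_on) blast
      show "pt ` {0..<T} \<subseteq> (\<Union>t\<in>{0..<T}. W t)" using ptW by fastforce
    qed
    have lG: "\<not> is_pole f (G (pt t)) \<and> f (G (pt t)) = h (pt t)" if "t \<in> {0..<T}" for t
      using G(1) ptW[OF that, of t] that unfolding lift_on_def by fastforce
    have TR: "pt T \<in> R" using ptR T by simp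
    have lim: "((\<lambda>t. h (pt t)) \<longlongrightarrow> h (pt T)) (at_left T)"
    proof -
      have "isCont h (pt T)"
        using h(1) R(1) TR holomorphic_on_imp_continuous_on continuous_on_eq_continuous_at by blast
      moreover have "(pt \<longlongrightarrow> pt T) (at_left T)"
        unfolding pt_def by (intro tendsto_intros)
      ultimately show ?thesis by (rule isCont_tendsto_compose)
    qed
    obtain c where c: "\<not> is_pole f c" "f c = h (pt T)"
      "\<And>e d. 0 < e \<Longrightarrow> d < T \<Longrightarrow> \<exists>t. d < t \<and> t \<in> {0..<T} \<and> G (pt t) \<in> ball c e"
      using lifted_path_accumulates[OF f T(1) cG lG lim sing(2)[OF TR]] by blast
    obtain \<delta> r k where k: "\<delta> > 0" "ball (pt T) \<delta> \<subseteq> R" "r > 0" "lift_on f h (ball (pt T) \<delta>) k"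
      "\<And>x y. x \<in> ball (pt T) \<delta> \<Longrightarrow> y \<in> ball c r \<Longrightarrow> f y = h x \<Longrightarrow> k x = y"
      using local_lift[OF f h(1) R(1) TR c(1,2) sing(1)[OF TR]] by blast
    have "open (pt -` ball (pt T) \<delta>)" using ptc open_vimage[of _ pt] by auto
    then obtain e where e: "e > 0" "ball T e \<subseteq> pt -` ball (pt T) \<delta>"
      using open_contains_ball[of "pt -` ball (pt T) \<delta>"] k(1) by fastforce
    \<comment> \<open>Convergence of the lift is not known, but at one time close to
      \<open>T\<close> its value is near \<open>c\<close>. There it must coincide with
      \<open>k\<close>, and one common value is enough for gluing.\<close>
    obtain t where t: "T - e < t" "t \<in> {0..<T}" "G (pt t) \<in> ball c r"
      using c(3)[OF k(3), of "T - e"] e(1) by auto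
    have ptB: "pt u \<in> ball (pt T) \<delta>" if "u \<in> {t..T}" for u
    proof -
      have "u \<in> ball T e" using that t by (auto simp: dist_real_def)
      then show ?thesis using e(2) by blast
    qed
    have "k (pt t) = G (pt t)" using k(5)[OF ptB t(3)] lG[OF t(2)] t(2) by simp
    then have eq: "g t (pt t) = k (pt t)" using G(2)[OF t(2) ptW[OF t(2), of t]] t(2) by simp
    define V where "V = W t \<union> ball (pt T) \<delta>"
    have V: "lift_on f h V (\<lambda>s. if s \<in> W t then g t s else k s)"
      unfolding V_def
    proof (rule lift_on_glue[where x = "pt t", OF f _ _ open_ball convex_ball _ k(4)])
      show "g t (pt t) = k (pt t)" by (rule eq)
      show "pt t \<in> W t" "pt t \<in> ball (pt T) \<delta>" using ptW t(2) ptB by auto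
      show "h ` W t \<inter> critical_values f = {}" using Wg t(2) crit unfolding P_def by blast
    qed (use W0[OF t(2)] in auto)
    have sub: "pt ` {0..T} \<subseteq> V"
    proof (rule image_subsetI)
      fix u assume "u \<in> {0..T}"
      then have "u \<in> {0..t} \<or> u \<in> {t..T}" by auto
      then show "pt u \<in> V" using ptW[OF t(2)] ptB unfolding V_def by blast
    qed
    moreover have "open V" using W0[OF t(2)] by (auto simp: V_def)
    moreover have "compact (pt ` {0..T})" by (intro compact_continuous_image ptc) simp
    \<comment> \<open>\<open>V\<close> is a union and may fail to be convex; a uniform neighbourhood
      of the segment inside it is convex again.\<close>
    ultimately obtain \<epsilon> where \<epsilon>: "\<epsilon> > 0" "(\<Union>x\<in>pt ` {0..T}. ball x \<epsilon>) \<subseteq> V"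
      using compact_subset_open_imp_ball_epsilon_subset by metis
    define N where "N = (\<Union>x\<in>pt ` {0..T}. ball x \<epsilon>)"
    have "V \<subseteq> R" using k(2) Wg t(2) unfolding V_def P_def by blast
    have "P T N (\<lambda>s. if s \<in> W t then g t s else k s)"
      unfolding P_def
    proof (intro conjI)
      show "open N" unfolding N_def by blast
      show "convex N" unfolding N_def by (intro convex_neighbourhood pt_conv) simp
      show "pt ` {0..T} \<subseteq> N" using \<epsilon>(1) unfolding N_def by (auto intro!: centre_in_ball)
      show "N \<subseteq> R" using \<epsilon>(2) \<open>V \<subseteq> R\<close> unfolding N_def by blast
      show "lift_on f h N (\<lambda>s. if s \<in> W t then g t s else k s)"
        using lift_on_subset[OF V] \<epsilon>(2) unfolding N_def .
      show "(if s0 \<in> W t then g t s0 else k s0) = a" using W0[OF t(2)] by simp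
    qed
    then show ?thesis unfolding Good_def by blast
  qed
  define S where "S = {t \<in> {0..1}. Good t}"
  have S: "0 \<in> S" "bdd_above S" using good_0 by (auto simp: S_def)
  define T where "T = Sup S"
  have "0 \<le> T" unfolding T_def using S by (rule cSup_upper)
  moreover have "T \<le> 1" unfolding T_def proof (rule cSup_least)
    show "S \<noteq> {}" using S(1) by blast
  qed (simp add: S_def)
  ultimately have T01: "0 \<le> T" "T \<le> 1" .
  have below: "Good t" if "t < T" for t
  proof -
    obtain x where "x \<in> S" "t < x" using \<open>t < T\<close> less_cSupD[of S t] S(1) unfolding T_def by blast
    then show ?thesis using good_mono[of x t] by (simp add: S_def)
  qed
  have "Good T"
  proof (cases "T = 0")
    case False
    then show ?thesis using good_closed T01 below by auto
  qed (use good_0 in simp)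
  have "T = 1"
  proof (rule ccontr)
    assume "T \<noteq> 1"
    obtain t' where t': "t' > T" "Good t'" using good_open \<open>Good T\<close> T01 by blast
    have "min t' 1 \<in> S" using t' T01 good_mono[OF t'(2), of "min t' 1"] by (auto simp: S_def)
    then have "min t' 1 \<le> T" unfolding T_def by (rule cSup_upper[OF _ S(2)])
    then show False using t' T01 \<open>T \<noteq> 1\<close> by auto
  qed
  then obtain W g where "P 1 W g" using \<open>Good T\<close> unfolding Good_def by blast
  then show ?thesis
    using that[of W g] pt01 unfolding P_def by (metis atLeastAtMost_iff image_subset_iff order_refl zero_le_one)
qed

text \<open>The neighbourhoods of the segments from \<open>s0\<close> to all points of
  \<open>R\<close> cover \<open>R\<close> and share the start, so their lifts fit together.\<close>

lemma lift_on_convex: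
  assumes f: "f nicely_meromorphic_on UNIV" and R: "open R" "convex R"
    and h: "h holomorphic_on R" "h ` R \<inter> singular_values f = {}"
    and s0: "s0 \<in> R" and a: "\<not> is_pole f a" "f a = h s0"
  obtains g where "lift_on f h R g" "g s0 = a"
proof -
  define P where "P s W g \<longleftrightarrow> open W \<and> convex W \<and> s0 \<in> W \<and> s \<in> W \<and> W \<subseteq> R \<and> lift_on f h W g \<and> g s0 = a"
    for s W g
  have "\<forall>s\<in>R. \<exists>W. \<exists>g. P s W g"
  proof
    fix s assume "s \<in> R"
    from lift_along_segment[OF f R h s0 this a] show "\<exists>W. \<exists>g. P s W g" unfolding P_def by metis
  qed
  from bchoice[OF this] obtain W where "\<forall>s\<in>R. \<exists>g. P s (W s) g" ..
  from bchoice[OF this] obtain g where Wg: "\<forall>s\<in>R. P s (W s) (g s)" ..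
  obtain G where G: "lift_on f h (\<Union>s\<in>R. W s) G" "\<And>t s. t \<in> R \<Longrightarrow> s \<in> W t \<Longrightarrow> G s = g t s"
  proof (rule lift_on_Union[OF f, of R W s0 h g a])
    show "h ` W i \<inter> critical_values f = {}" if "i \<in> R" for i
      using Wg that h(2) unfolding P_def singular_values_def by blast
  qed (use Wg in \<open>unfold P_def, blast\<close>)+
  have "(\<Union>s\<in>R. W s) = R" using Wg unfolding P_def by blast
  moreover have "G s0 = a" using G(2)[OF s0, of s0] Wg s0 unfolding P_def by simp
  ultimately show ?thesis using G(1) that by simp
qed

text \<open>Each step lifts through the outermost \<open>f\<close>. The lift again misses the
  postsingular set, because finite images of postsingular points are postsingular, so the induction
  continues with the lift in place of \<open>h\<close>.\<close>

lemma lift_iterate: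
  assumes f: "f nicely_meromorphic_on UNIV" and R: "open R" "convex R" "s0 \<in> R"
    and h: "h holomorphic_on R" "h ` R \<inter> postsingular_set f = {}" and a: "iter f N a = Fin (h s0)"
  shows "\<exists>g. g holomorphic_on R \<and> g s0 = a \<and> (\<forall>s\<in>R. iter f N (g s) = Fin (h s))"
  using h a
proof (induction N arbitrary: h)
  case 0
  then show ?case by (intro exI[of _ h]) auto
next
  case (Suc N)
  obtain w where w: "iter f N a = Fin w" "\<not> is_pole f w" "f w = h s0"
    using Suc.prems(3) unfolding iter_Suc_eq_Fin by blast
  have "singular_values f \<subseteq> postsingular_set f"
  proof
    fix x assume "x \<in> singular_values f"
    then show "x \<in> postsingular_set f"
      unfolding postsingular_set_def using closure_subset
      by (intro CollectI bexI[of _ x] exI[of _ 0]) auto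
  qed
  then have "h ` R \<inter> singular_values f = {}" using Suc.prems(2) by blast
  from lift_on_convex[OF f R(1,2) Suc.prems(1) this R(3) w(2,3)]
  obtain g where g: "lift_on f h R g" "g s0 = w" by blast
  have "g s \<notin> postsingular_set f" if s: "s \<in> R" for s
  proof
    assume "g s \<in> postsingular_set f"
    then obtain x n where x: "x \<in> closure (singular_values f)" "iter f n x = Fin (g s)"
      unfolding postsingular_set_def by blast
    then have "iter f (Suc n) x = Fin (h s)"
      using g(1) s unfolding iter_Suc_eq_Fin lift_on_def by blast
    then have "h s \<in> postsingular_set f" using x(1) unfolding postsingular_set_def by blast
    then show False using Suc.prems(2) s by blast
  qed
  then have "g ` R \<inter> postsingular_set f = {}" by blast
  moreover have "g holomorphic_on R" using g(1) unfolding lift_on_def by blast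
  moreover have "iter f N a = Fin (g s0)" using w g by simp
  ultimately obtain k where k: "k holomorphic_on R" "k s0 = a" "\<forall>s\<in>R. iter f N (k s) = Fin (g s)"
    using Suc.IH[of g] by blast
  then have "iter f (Suc N) (k s) = Fin (h s)" if "s \<in> R" for s
    using that g(1) unfolding iter_Suc_eq_Fin lift_on_def by blast
  then show ?case using k by blast
qed

section \<open>Inverse branches near a Baker domain\<close>

text \<open>The functions \<open>G k\<close> are injective inverse branches of iterates, so they omit one point of each
  pair with equal images and form a normal family. A nonconstant limit would have all the iterates
  injective near its value at \<open>x1\<close>; the value of a constant one is \<open>z\<close>, a Fatou point that is a limit
  of the non-Fatou points \<open>G k x1\<close>.\<close>

lemma inverse_branches_contradiction:
  assumes f: "f nicely_meromorphic_on UNIV" and ess: "essential_at_infinity f"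
    and np: "\<not> is_pole f a0"
    and N: "filterlim N at_top sequentially" "\<And>k. N k \<ge> (1::nat)"
    and R: "open R" "connected R" "x0 \<in> R" "x1 \<in> R"
    and h: "\<And>k. inj_on (h k) R" and G: "\<And>k. G k holomorphic_on R"
    and lift: "\<And>k s. s \<in> R \<Longrightarrow> iter f (N k) (G k s) = Fin (h k s)"
    and lim: "(\<lambda>k. G k x0) \<longlonglongrightarrow> z" and z: "z \<in> fatou_set f"
    and notF: "\<And>k. G k x1 \<notin> fatou_set f"
  shows False
proof -
  obtain a1 b1 a2 b2 where pairs: "f a1 = f b1" "f a2 = f b2" "distinct [a1, b1, a2, b2]"
    and nps: "\<And>x. x \<in> {a1, b1, a2, b2} \<Longrightarrow> \<not> is_pole f x"
    using essential_two_pairs[OF f ess np] by metis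
  have omit: "(\<forall>s\<in>R. G k s \<noteq> a) \<or> (\<forall>s\<in>R. G k s \<noteq> b)"
    if "f a = f b" "a \<noteq> b" "\<not> is_pole f a" "\<not> is_pole f b" for a b k
  proof (rule ccontr)
    assume "\<not> ?thesis"
    then obtain s t where st: "s \<in> R" "t \<in> R" "G k s = a" "G k t = b" by blast
    \<comment> \<open>As \<open>N k\<close> is at least 1, a first application of \<open>f\<close>
      can be split off, and it already merges the two points of a pair.\<close>
    have "iter f (N k) x = iter f (N k - 1) (f x)" if "\<not> is_pole f x" for x
      using iter_add[of f 1 "N k - 1" x] N(2)[of k] that by (simp add: sphere_map_def)
    then have "Fin (h k s) = Fin (h k t)"
      using that lift[OF st(1), of k] lift[OF st(2), of k] st(3,4) by simp
    then have "s = t" using inj_onD[OF h _ st(1,2)] by simp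
    then show False using st that by simp
  qed
  define Q where "Q a b = {k. \<forall>s\<in>R. G k s \<noteq> a \<and> G k s \<noteq> b}" for a b
  have "k \<in> Q a1 a2 \<union> Q a1 b2 \<union> Q b1 a2 \<union> Q b1 b2" for k
    using omit[OF pairs(1), of k] omit[OF pairs(2), of k] pairs(3) nps unfolding Q_def by auto
  then have "Q a1 a2 \<union> Q a1 b2 \<union> Q b1 a2 \<union> Q b1 b2 = UNIV" by blast
  then have "infinite (Q a1 a2) \<or> infinite (Q a1 b2) \<or> infinite (Q b1 a2) \<or> infinite (Q b1 b2)"
    by (metis finite_Un infinite_UNIV_nat)
  then obtain a b where ab: "infinite (Q a b)" "a \<noteq> b"
    using pairs(3) by auto
  obtain r where r: "strict_mono (r :: nat \<Rightarrow> nat)" "\<And>n. r n \<in> Q a b"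
    using infinite_enumerate[OF ab(1)] by blast
  \<comment> \<open>Convergence at \<open>x0\<close> bounds the family there, so the limit in
    Montel's theorem is finite.\<close>
  obtain B where B: "\<And>k. cmod (G k x0) \<le> B"
    using convergent_imp_Bseq[OF convergentI[OF lim]] unfolding Bseq_def by blast
  obtain g s where g: "g holomorphic_on R" "strict_mono (s :: nat \<Rightarrow> nat)"
    "\<And>x. x \<in> R \<Longrightarrow> (\<lambda>n. G (r (s n)) x) \<longlonglongrightarrow> g x"
    "\<And>K. \<lbrakk>compact K; K \<subseteq> R\<rbrakk> \<Longrightarrow> uniform_limit K ((\<lambda>n. G (r n)) \<circ> s) g sequentially"
  proof (rule Montel[OF R(1), of "range (\<lambda>n. G (r n))" "\<lambda>n. G (r n)"])
    fix K assume K: "compact K" "K \<subseteq> R"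
    show "\<exists>B. \<forall>h\<in>range (\<lambda>n. G (r n)). \<forall>z\<in>K. cmod (h z) \<le> B"
    proof (rule omitting_affine_bounded[OF R(1-3) ab(2) _ _ _ K])
      fix h assume "h \<in> range (\<lambda>n. G (r n))"
      then obtain n where n: "h = G (r n)" by blast
      show "h holomorphic_on R" "cmod (h x0) \<le> B" using G B n by auto
      show "h z \<noteq> a \<and> h z \<noteq> b" if "z \<in> R" for z
        using r(2)[of n] that unfolding n Q_def by blast
    qed
  qed (use G in auto)
  define H where "H j = G (r (s j))" for j
  define M where "M j = N (r (s j))" for j
  have H_ul: "uniform_limit K H g sequentially" if "compact K" "K \<subseteq> R" for K
    using g(4)[OF that] by (simp add: o_def H_def[abs_def])
  have "filterlim (\<lambda>j. r (s j)) at_top sequentially"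
    using filterlim_subseq[OF strict_mono_o[OF r(1) g(2)]] by (simp add: o_def)
  from filterlim_compose[OF N(1) this] have M: "filterlim M at_top sequentially"
    by (simp add: M_def[abs_def])
  have "(\<lambda>j. G (r (s j)) x0) \<longlonglongrightarrow> z"
    using LIMSEQ_subseq_LIMSEQ[OF lim strict_mono_o[OF r(1) g(2)]] by (simp add: o_def)
  then have gz: "g x0 = z" using g(3)[OF R(3)] LIMSEQ_unique by blast
  have g1: "g x1 \<notin> fatou_set f"
    using closed_sequentially[of "- fatou_set f" "\<lambda>n. G (r (s n)) x1" "g x1"] fatou_set_open[of f] notF g(3)[OF R(4)]
    by (simp add: closed_def)
  have nc: "\<not> g constant_on R"
    using gz g1 z R unfolding constant_on_def by metis
  \<comment> \<open>By Hurwitz: otherwise points \<open>w i\<close> tending to \<open>g x1\<close>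
    are missed by \<open>H (j i)\<close> with \<open>j i\<close> growing, and the zero-free
    functions \<open>H (j i) - w i\<close> would tend to a nonconstant function vanishing at
    \<open>x1\<close>.\<close>
  have "\<exists>\<rho>>0. \<forall>J. \<exists>j\<ge>J. ball (g x1) \<rho> \<subseteq> H j ` R"
  proof (rule ccontr)
    assume neg: "\<not> ?thesis"
    have "\<exists>j w. j \<ge> i \<and> w \<in> ball (g x1) (1 / Suc i) \<and> w \<notin> H j ` R" for i
    proof -
      have "1 / real (Suc i) > 0" by simp
      then obtain J where J: "\<And>j. j \<ge> J \<Longrightarrow> \<not> ball (g x1) (1 / Suc i) \<subseteq> H j ` R"
        using neg by blast
      have "\<not> ball (g x1) (1 / Suc i) \<subseteq> H (max i J) ` R" by (rule J) simp
      then show ?thesis by (meson max.cobounded1 subsetI)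
    qed
    then have "\<forall>i. \<exists>j. \<exists>w. j \<ge> i \<and> w \<in> ball (g x1) (1 / Suc i) \<and> w \<notin> H j ` R" by blast
    from choice[OF this] obtain j where "\<forall>i. \<exists>w. j i \<ge> i \<and> w \<in> ball (g x1) (1 / Suc i) \<and> w \<notin> H (j i) ` R" ..
    from choice[OF this] obtain w where w: "\<And>i. j i \<ge> i" "\<And>i. w i \<in> ball (g x1) (1 / Suc i)" "\<And>i. w i \<notin> H (j i) ` R"
      by blast
    have jlim: "filterlim j at_top sequentially"
      using w(1) by (intro filterlim_at_top_mono[OF filterlim_ident]) auto
    have "(\<lambda>i. dist (w i) (g x1)) \<longlonglongrightarrow> 0"
    proof (rule tendsto_sandwich[OF _ _ tendsto_const])
      show "eventually (\<lambda>i. dist (w i) (g x1) \<le> 1 / Suc i) sequentially"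
        using w(2) by (intro always_eventually) (auto simp: dist_commute less_imp_le)
      show "(\<lambda>i. 1 / Suc i) \<longlonglongrightarrow> (0::real)" by real_asymp
    qed auto
    then have wlim: "w \<longlonglongrightarrow> g x1" by (rule tendsto_dist_iff[THEN iffD2])
    have "g x1 - g x1 \<noteq> 0"
    proof (rule Hurwitz_no_zeros[OF R(1,2), of "\<lambda>i x. H (j i) x - w i" "\<lambda>x. g x - g x1" x1])
      show "(\<lambda>x. H (j i) x - w i) holomorphic_on R" for i
        unfolding H_def by (intro holomorphic_intros G)
      show "(\<lambda>x. g x - g x1) holomorphic_on R" by (intro holomorphic_intros g(1))
      show "uniform_limit K (\<lambda>i x. H (j i) x - w i) (\<lambda>x. g x - g x1) sequentially"
        if "compact K" "K \<subseteq> R" for K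
      proof (rule uniform_limit_minus)
        show "uniform_limit K (\<lambda>i. H (j i)) g sequentially"
          using filterlim_compose[OF H_ul[OF that] jlim] .
        show "uniform_limit K (\<lambda>i x. w i) (\<lambda>x. g x1) sequentially"
          using wlim unfolding uniform_limit_iff tendsto_iff
          by (auto elim: eventually_mono)
      qed
      show "\<not> (\<lambda>x. g x - g x1) constant_on R"
        using nc unfolding constant_on_def by (metis diff_add_cancel)
      show "H (j i) x - w i \<noteq> 0" if "x \<in> R" for i x using w(3)[of i] that by (metis eq_iff_diff_eq_0 image_eqI)
    qed (rule R(4))
    then show False by simp
  qed
  then obtain \<rho> where \<rho>: "\<rho> > 0" "\<And>J. \<exists>j\<ge>J. ball (g x1) \<rho> \<subseteq> H j ` R" by blast
  \<comment> \<open>The disc stays fixed while the order \<open>M j\<close> of the inverted iterate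
    is as large as desired, so information on iterates of every order m is available on it.\<close>
  have large: "\<exists>j. M j \<ge> m \<and> ball (g x1) \<rho> \<subseteq> H j ` R" for m
    using M \<rho>(2) unfolding filterlim_at_top eventually_sequentially by meson
  have HM: "iter f (M j) (H j t) = Fin (h (r (s j)) t)" if "t \<in> R" for j t
    unfolding M_def H_def using lift[OF that] .
  have fin: "iter f m x \<noteq> Infty" if x: "x \<in> ball (g x1) \<rho>" for m x
  proof -
    obtain j where j: "M j \<ge> m" "ball (g x1) \<rho> \<subseteq> H j ` R" using large by blast
    then obtain t where "t \<in> R" "x = H j t" using x by blast
    then have "iter f (M j) x \<noteq> Infty" using HM by simp
    then show ?thesis using j(1) by (rule iter_finite_mono)
  qed
  \<comment> \<open>On the image of \<open>H j\<close> the iterate \<open>f ^^ M j\<close> is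
    injective, because composing it with \<open>H j\<close> gives the injective \<open>h\<close>;
    hence so is its inner factor \<open>f ^^ m\<close>.\<close>
  have inj: "inj_on (f ^^ m) (ball (g x1) \<rho>)" for m
  proof -
    obtain j where j: "M j \<ge> m" "ball (g x1) \<rho> \<subseteq> H j ` R" using large by blast
    have val: "(f ^^ M j) (H j t) = h (r (s j)) t" if "t \<in> R" for t
      using iter_eq_funpow[of f "M j" "H j t"] HM[OF that] by simp
    have "inj_on (f ^^ M j) (H j ` R)"
      using h[of "r (s j)"] by (auto simp: inj_on_def val)
    moreover have "f ^^ M j = f ^^ (M j - m) \<circ> f ^^ m"
      using j(1) by (simp flip: funpow_add)
    ultimately show ?thesis
      using j(2) by (metis inj_on_imageI2 inj_on_subset)
  qed
  have "g x1 \<in> fatou_set f"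
    by (rule injective_iterates_fatou[OF f \<rho>(1) fin inj pairs])
  then show False using g1 by contradiction
qed

section \<open>Circular arcs from the Baker domain to its boundary, and escape of orbits\<close>

text \<open>On an unbounded connected set the modulus takes all large values, so \<open>C\<close>
  meets every large circle about 0. The principal argument provides an angle of at most half a
  turn.\<close>

lemma circle_meets_complement:
  assumes C: "C \<in> components (- U)" "\<not> bounded C"
  obtains \<rho> where "\<rho> > 0" "\<And>u. cmod u \<ge> \<rho> \<Longrightarrow> \<exists>\<theta>\<in>{-pi..pi}. u * exp (\<i> * of_real \<theta>) \<notin> U"
proof -
  obtain e0 where e0: "e0 \<in> C" using in_components_nonempty[OF C(1)] by blast
  have "\<exists>\<theta>\<in>{-pi..pi}. u * exp (\<i> * of_real \<theta>) \<notin> U" if u: "cmod u \<ge> cmod e0 + 1" for u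
  proof -
    obtain e1 where e1: "e1 \<in> C" "cmod e1 > cmod u"
      using C(2) unfolding bounded_iff by (meson not_le)
    have "connected (cmod ` C)"
      using in_components_connected[OF C(1)] by (intro connected_continuous_image continuous_intros)
    then have "{cmod e0..cmod e1} \<subseteq> cmod ` C"
      using connected_contains_Icc e0 e1(1) by blast
    moreover have "cmod u \<in> {cmod e0..cmod e1}" using u e1(2) by simp
    ultimately obtain w where w: "w \<in> C" "cmod w = cmod u" by (metis imageE subsetD)
    have "u \<noteq> 0" using u by (metis add_nonneg_pos norm_ge_zero norm_zero not_le zero_less_one)
    then have 1: "cmod (w / u) = 1" using w(2) by (simp add: norm_divide)
    then have "w / u = exp (\<i> * of_real (Arg (w / u)))"
      using Arg_eq[of "w / u"] by (metis mult_1 norm_zero of_real_1 zero_neq_one)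
    then have "u * exp (\<i> * of_real (Arg (w / u))) = w" using \<open>u \<noteq> 0\<close> by (metis nonzero_mult_div_cancel_left times_divide_eq_right)
    moreover have "w \<notin> U" using w(1) in_components_subset[OF C(1)] by blast
    moreover have "Arg (w / u) \<in> {-pi..pi}" using mpi_less_Arg[of "w / u"] Arg_le_pi[of "w / u"] by simp
    ultimately show ?thesis by metis
  qed
  then show ?thesis using that[of "cmod e0 + 1"] by (simp add: add_nonneg_pos)
qed

text \<open>By compactness there is an exit angle of least absolute value, and every smaller
  rotation in the same direction stays in \<open>U\<close>. It is nonzero because \<open>u\<close>
  itself lies in \<open>U\<close>.\<close>

lemma nearest_exit_along_circle:
  assumes "open U" "u \<in> U" "\<exists>\<theta>\<in>{-pi..pi}. u * exp (\<i> * of_real \<theta>) \<notin> U"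
  obtains \<theta> where "\<theta> \<in> {-pi..pi}" "\<theta> \<noteq> 0" "u * exp (\<i> * of_real \<theta>) \<notin> U"
    "\<And>t. t \<in> {0..<1} \<Longrightarrow> u * exp (\<i> * of_real \<theta> * of_real t) \<in> U"
proof -
  define \<Theta> where "\<Theta> = {-pi..pi} \<inter> (\<lambda>\<theta>. u * exp (\<i> * of_real \<theta>)) -` (- U)"
  have "closed \<Theta>"
    unfolding \<Theta>_def using assms(1)
    by (intro continuous_closed_preimage continuous_intros) auto
  moreover have "bounded \<Theta>" unfolding \<Theta>_def by (rule bounded_subset[of "{-pi..pi}"]) auto
  ultimately have "compact \<Theta>" by (simp add: compact_eq_bounded_closed)
  moreover have "\<Theta> \<noteq> {}" using assms(3) unfolding \<Theta>_def by blast
  moreover have "continuous_on \<Theta> (\<lambda>x. \<bar>x\<bar>)" by (intro continuous_intros)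
  ultimately obtain \<theta> where \<theta>: "\<theta> \<in> \<Theta>" "\<And>y. y \<in> \<Theta> \<Longrightarrow> \<bar>\<theta>\<bar> \<le> \<bar>y\<bar>"
    using continuous_attains_inf[of \<Theta> "\<lambda>x. \<bar>x\<bar>"] by blast
  have nz: "\<theta> \<noteq> 0" using \<theta>(1) assms(2) by (auto simp: \<Theta>_def)
  show ?thesis
  proof (rule that[of \<theta>])
    show "\<theta> \<in> {-pi..pi}" "u * exp (\<i> * of_real \<theta>) \<notin> U" using \<theta>(1) by (auto simp: \<Theta>_def)
    show "u * exp (\<i> * of_real \<theta> * of_real t) \<in> U" if t: "t \<in> {0..<1}" for t
    proof (rule ccontr)
      assume out: "u * exp (\<i> * of_real \<theta> * of_real t) \<notin> U"
      have less: "\<bar>\<theta> * t\<bar> < \<bar>\<theta>\<bar>" using t nz by (simp add: abs_mult)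
      moreover have "\<bar>\<theta>\<bar> \<le> pi" using \<theta>(1) by (auto simp: \<Theta>_def)
      ultimately have "\<theta> * t \<in> {-pi..pi}" by (simp add: abs_if split: if_splits)
      then have "\<theta> * t \<in> \<Theta>" using out unfolding \<Theta>_def by (simp add: mult.assoc)
      then show False using \<theta>(2)[of "\<theta> * t"] less by simp
    qed
  qed (rule nz)
qed

lemma baker_domain_escape:
  assumes B: "baker_domain f U p" and K: "compact K" "K \<subseteq> U"
  shows "\<exists>N. \<forall>n\<ge>N. \<forall>z\<in>K. cmod ((f ^^ (p * n)) z) \<ge> b"
proof -
  \<comment> \<open>The chordal distance from \<open>Infty\<close> of the points of modulus
    |b|.\<close>
  define e where "e = 2 / sqrt (1 + b\<^sup>2)"
  have pos: "1 + b\<^sup>2 > 0" by (simp add: add_pos_nonneg)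
  have "e > 0" using pos by (simp add: e_def)
  moreover have "uniform_limit K (\<lambda>n. iter f (p * n)) (\<lambda>_. Infty) sequentially"
    using B K unfolding baker_domain_def by blast
  ultimately obtain N where N: "\<And>n z. n \<ge> N \<Longrightarrow> z \<in> K \<Longrightarrow> dist (iter f (p * n) z) Infty < e"
    unfolding uniform_limit_iff eventually_sequentially by blast
  have U: "U \<subseteq> fatou_set f"
    using B in_components_subset unfolding baker_domain_def by blast
  have "cmod ((f ^^ (p * n)) z) \<ge> b" if "n \<ge> N" "z \<in> K" for n z
  proof -
    have "iter f (p * n) z = Fin ((f ^^ (p * n)) z)"
      using U K that by (intro iter_eq_funpow fatou_set_iter_finite) auto
    with N[OF that] have less: "2 / sqrt (1 + (cmod ((f ^^ (p * n)) z))\<^sup>2) < 2 / sqrt (1 + b\<^sup>2)"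
      by (simp add: dist_Fin_Infty e_def)
    have "1 + (cmod ((f ^^ (p * n)) z))\<^sup>2 > 0" by (simp add: add_pos_nonneg)
    then have "b\<^sup>2 < (cmod ((f ^^ (p * n)) z))\<^sup>2"
      using less pos by (simp add: divide_less_cancel frac_less2 field_simps)
    then show ?thesis by (meson less_imp_le norm_ge_zero power2_less_imp_less)
  qed
  then show ?thesis by blast
qed

lemma baker_domain_funpow_mem:
  assumes B: "baker_domain f U p" and z: "z \<in> U"
  shows "(f ^^ (p * n)) z \<in> U"
proof (induction n)
  case (Suc n)
  have U: "U \<subseteq> fatou_set f"
    using B in_components_subset unfolding baker_domain_def by blast
  have per: "iter f p ` U \<subseteq> Fin ` U" using B unfolding baker_domain_def has_period_def by blast
  have "iter f p x = Fin ((f ^^ p) x)" if "x \<in> U" for x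
    using U that by (intro iter_eq_funpow fatou_set_iter_finite) auto
  then have "(f ^^ p) x \<in> U" if "x \<in> U" for x using per that by force
  from this[OF Suc.IH] show ?case by (simp add: funpow_add[symmetric] flip: comp_apply[of "f ^^ p"])
qed (use z in simp)

text \<open>Components of an open set are open, so a component containing \<open>x\<close> would
  meet \<open>U\<close> and hence equal it.\<close>

lemma frontier_component_not_mem:
  assumes S: "open S" and U: "U \<in> components S" and x: "x \<in> closure U" "x \<notin> U"
  shows "x \<notin> (S :: complex set)"
proof
  assume "x \<in> S"
  then obtain C where C: "C \<in> components S" "x \<in> C" using Union_components[of S] by blast
  have "open C" using open_components[OF S C(1)] .
  then have "C \<inter> U \<noteq> {}" using x(1) C(2) open_Int_closure_eq_empty by blast
  then have "C = U" using components_nonoverlap[OF C(1) U] by blast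
  then show False using C x by blast
qed

section \<open>Postsingular points near late iterates of a compact set\<close>

text \<open>Failure would give points of \<open>K\<close> and iterates of unbounded order whose arcs
  have neighbourhoods free of postsingular points; the branches over these are excluded by
  \<open>inverse_branches_contradiction\<close>. Uniformity over \<open>K\<close> later allows a
  starting point to be chosen for each prescribed modulus.\<close>

lemma postsingular_near_orbit:
  assumes f: "f nicely_meromorphic_on UNIV" and B: "baker_domain f U p"
    and comp: "\<exists>C\<in>components (- U). \<not> bounded C"
    and K: "compact K" "K \<subseteq> U" and \<epsilon>: "\<epsilon> > 0"
  shows "\<exists>N. \<forall>n\<ge>N. \<forall>z\<in>K. \<exists>q\<in>postsingular_set f.
    \<bar>cmod q - cmod ((f ^^ (p * n)) z)\<bar> \<le> \<epsilon> * cmod ((f ^^ (p * n)) z) \<and>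
    infdist q U \<le> \<epsilon> * cmod ((f ^^ (p * n)) z)"
proof (rule ccontr)
  assume neg: "\<not> ?thesis"
  have ess: "essential_at_infinity f" and UF: "U \<in> components (fatou_set f)" and p: "p \<ge> 1"
    using B unfolding baker_domain_def has_period_def by auto
  have Usub: "U \<subseteq> fatou_set f" using in_components_subset[OF UF] .
  have "open U" using open_components[OF fatou_set_open UF] .
  obtain \<rho> where \<rho>: "\<rho> > 0" "\<And>u. cmod u \<ge> \<rho> \<Longrightarrow> \<exists>\<theta>\<in>{-pi..pi}. u * exp (\<i> * of_real \<theta>) \<notin> U"
    using circle_meets_complement comp by metis
  obtain N0 where N0: "\<And>n z. n \<ge> N0 \<Longrightarrow> z \<in> K \<Longrightarrow> cmod ((f ^^ (p * n)) z) \<ge> \<rho>"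
    using baker_domain_escape[OF B K] by blast
  have "isCont exp (0::complex)" by (rule isCont_exp)
  then obtain \<eta> where \<eta>: "\<eta> > 0" "\<And>x. cmod x < \<eta> \<Longrightarrow> cmod (exp x - 1) < \<epsilon>"
    using \<epsilon> unfolding continuous_at_eps_delta by (auto simp: dist_norm)
  \<comment> \<open>The bound 1/4 keeps the angles within less than a full turn. As |\<theta>| is at
    most pi, the bound \<open>\<eta> / pi\<close> keeps the exponent within \<eta> of one on the
    arc, a relative error below \<epsilon>.\<close>
  define \<delta> where "\<delta> = min (1 / 4) (\<eta> / pi)"
  have \<delta>: "\<delta> > 0" "\<delta> \<le> 1 / 4" "pi * \<delta> \<le> \<eta>"
    using \<eta> by (auto simp: \<delta>_def min_def field_simps)
  \<comment> \<open>The core is half-open so that all of it is mapped into \<open>U\<close>; the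
    thickening still covers 1, which is mapped to the exit point.\<close>
  define R :: "complex set" where "R = (\<Union>x\<in>of_real ` {0..<1}. ball x \<delta>)"
  have R: "open R" "convex R" "0 \<in> R" "1 \<in> R"
  proof -
    show "open R" unfolding R_def by blast
    have "convex ((\<lambda>t::real. complex_of_real t) ` {0..<1})"
      by (rule convex_linear_image) (auto intro: bounded_linear.linear bounded_linear_of_real)
    then show "convex R" unfolding R_def by (rule convex_neighbourhood)
    show "0 \<in> R" unfolding R_def using \<delta>(1) by (intro UN_I[of 0]) (auto intro!: image_eqI[of _ _ 0])
    have "(1::complex) \<in> ball (of_real (1 - \<delta> / 2)) \<delta>"
      using \<delta>(1) by (simp add: dist_norm norm_divide)
    moreover have "complex_of_real (1 - \<delta> / 2) \<in> of_real ` {0..<1}"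
      using \<delta> by (intro imageI) auto
    ultimately show "1 \<in> R" unfolding R_def by blast
  qed
  \<comment> \<open>\<open>N0\<close> makes the modulus large enough for an exit from
    \<open>U\<close> to exist, k drives the order to infinity, and 1 makes it positive.\<close>
  have "\<forall>k. \<exists>n. \<exists>z. n \<ge> N0 + k + 1 \<and> z \<in> K \<and> (\<forall>q\<in>postsingular_set f.
    \<not> (\<bar>cmod q - cmod ((f ^^ (p * n)) z)\<bar> \<le> \<epsilon> * cmod ((f ^^ (p * n)) z) \<and>
    infdist q U \<le> \<epsilon> * cmod ((f ^^ (p * n)) z)))"
    using neg by blast
  from choice[OF this] obtain n where "\<forall>k. \<exists>z. n k \<ge> N0 + k + 1 \<and> z \<in> K \<and> (\<forall>q\<in>postsingular_set f.
    \<not> (\<bar>cmod q - cmod ((f ^^ (p * n k)) z)\<bar> \<le> \<epsilon> * cmod ((f ^^ (p * n k)) z) \<and>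
    infdist q U \<le> \<epsilon> * cmod ((f ^^ (p * n k)) z)))" ..
  from choice[OF this] obtain z where nz: "\<And>k. n k \<ge> N0 + k + 1" "\<And>k. z k \<in> K"
    and bad: "\<And>k q. q \<in> postsingular_set f \<Longrightarrow>
    \<not> (\<bar>cmod q - cmod ((f ^^ (p * n k)) (z k))\<bar> \<le> \<epsilon> * cmod ((f ^^ (p * n k)) (z k)) \<and>
    infdist q U \<le> \<epsilon> * cmod ((f ^^ (p * n k)) (z k)))" by blast
  have zU: "z k \<in> U" for k using nz(2) K(2) by blast
  define u where "u k = (f ^^ (p * n k)) (z k)" for k
  have uU: "u k \<in> U" for k
    unfolding u_def by (rule baker_domain_funpow_mem[OF B zU])
  have u\<rho>: "cmod (u k) \<ge> \<rho>" for k
    unfolding u_def using nz(1)[of k] by (intro N0 nz(2)) simp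
  then have u0: "u k \<noteq> 0" for k using \<rho>(1) by (metis norm_zero not_le)
  have "\<exists>\<theta>. \<theta> \<in> {-pi..pi} \<and> \<theta> \<noteq> 0 \<and> u k * exp (\<i> * of_real \<theta>) \<notin> U \<and>
    (\<forall>t\<in>{0..<1}. u k * exp (\<i> * of_real \<theta> * of_real t) \<in> U)" for k
    using nearest_exit_along_circle[OF \<open>open U\<close> uU \<rho>(2)[OF u\<rho>]] by metis
  then have "\<forall>k. \<exists>\<theta>. \<theta> \<in> {-pi..pi} \<and> \<theta> \<noteq> 0 \<and> u k * exp (\<i> * of_real \<theta>) \<notin> U \<and>
    (\<forall>t\<in>{0..<1}. u k * exp (\<i> * of_real \<theta> * of_real t) \<in> U)" by blast
  from choice[OF this] obtain \<theta> where \<theta>: "\<And>k. \<theta> k \<in> {-pi..pi}" "\<And>k. \<theta> k \<noteq> 0"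
    "\<And>k. u k * exp (\<i> * of_real (\<theta> k)) \<notin> U"
    "\<And>k t. t \<in> {0..<1} \<Longrightarrow> u k * exp (\<i> * of_real (\<theta> k) * of_real t) \<in> U" by blast
  \<comment> \<open>Rescaling the angle by \<open>\<theta> k\<close> makes the domain \<open>R\<close> independent of \<open>k\<close>.\<close>
  define h where "h k s = u k * exp (\<i> * of_real (\<theta> k) * s)" for k s
  have h_hol: "h k holomorphic_on A" for k A
    unfolding h_def by (intro holomorphic_intros)
  have h_U: "h k (of_real t) \<in> U" if "t \<in> {0..<1}" for k t
    unfolding h_def using \<theta>(4)[OF that] .
  have h_norm: "cmod (h k (of_real t)) = cmod (u k)" for k t
    by (simp add: h_def norm_mult)
  have h_close: "\<exists>t\<in>{0..<1}. cmod (h k s - h k (of_real t)) \<le> \<epsilon> * cmod (u k)" if s: "s \<in> R" for k s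
  proof -
    obtain t where t: "t \<in> {0..<1}" "s \<in> ball (of_real t) \<delta>" using s unfolding R_def by blast
    define x where "x = \<i> * of_real (\<theta> k) * (s - of_real t)"
    have "\<bar>\<theta> k\<bar> \<le> pi" using \<theta>(1)[of k] by auto
    moreover have "cmod (s - of_real t) < \<delta>" using t(2) by (simp add: dist_norm norm_minus_commute)
    ultimately have "\<bar>\<theta> k\<bar> * cmod (s - of_real t) < pi * \<delta>"
      using pi_gt_zero by (smt (verit) mult_mono' mult_strict_left_mono norm_ge_zero abs_ge_zero mult_right_mono)
    then have "cmod x < \<eta>" using \<delta>(3) by (simp add: x_def norm_mult)
    then have "cmod (exp x - 1) < \<epsilon>" by (rule \<eta>(2))
    moreover have "h k s - h k (of_real t) = h k (of_real t) * (exp x - 1)"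
    proof -
      have "\<i> * of_real (\<theta> k) * s = \<i> * of_real (\<theta> k) * of_real t + x" by (simp add: x_def algebra_simps)
      then show ?thesis unfolding h_def by (simp add: exp_add algebra_simps)
    qed
    then have "cmod (h k s - h k (of_real t)) = cmod (u k) * cmod (exp x - 1)"
      using h_norm by (simp add: norm_mult)
    ultimately have "cmod (h k s - h k (of_real t)) \<le> cmod (u k) * \<epsilon>"
      by (simp add: mult_left_mono)
    then show ?thesis using t(1) by (auto simp: mult.commute)
  qed
  \<comment> \<open>A postsingular point here would be within the tolerance of a point of
    \<open>U\<close> of modulus |u k|, contrary to the choice of \<open>n k\<close> and
    \<open>z k\<close>.\<close>
  have h_P: "h k ` R \<inter> postsingular_set f = {}" for k
  proof (rule ccontr)
    assume "h k ` R \<inter> postsingular_set f \<noteq> {}"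
    then obtain s where s: "s \<in> R" "h k s \<in> postsingular_set f" by blast
    obtain t where t: "t \<in> {0..<1}" "cmod (h k s - h k (of_real t)) \<le> \<epsilon> * cmod (u k)"
      using h_close[OF s(1)] by blast
    have "\<bar>cmod (h k s) - cmod (u k)\<bar> \<le> \<epsilon> * cmod (u k)"
      using norm_triangle_ineq3[of "h k s" "h k (of_real t)"] t(2) unfolding h_norm by linarith
    moreover have "infdist (h k s) U \<le> \<epsilon> * cmod (u k)"
      using infdist_le2[OF h_U[OF t(1), of k]] t(2) by (simp add: dist_norm)
    ultimately show False using bad[OF s(2), of k] unfolding u_def by blast
  qed
  \<comment> \<open>Real parts in \<open>R\<close> differ by less than 3/2 and |\<theta> k| is at
    most pi, so angles differ by at most 3 pi / 2, less than a period of the exponential.\<close>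
  have h_inj: "inj_on (h k) R" for k
  proof (rule inj_onI)
    fix s s' assume s: "s \<in> R" "s' \<in> R" "h k s = h k s'"
    have Re_bd: "- \<delta> < Re x \<and> Re x < 1 + \<delta>" if x: "x \<in> R" for x
    proof -
      obtain t where t: "t \<in> {0..<1}" "x \<in> ball (of_real t) \<delta>" using x unfolding R_def by blast
      have "\<bar>Re (x - of_real t)\<bar> < \<delta>"
        using t(2) abs_Re_le_cmod[of "x - of_real t"] by (simp add: dist_norm norm_minus_commute)
      then show ?thesis using t(1) by auto
    qed
    have "exp (\<i> * of_real (\<theta> k) * s) = exp (\<i> * of_real (\<theta> k) * s')"
      using s(3) u0 by (simp add: h_def)
    then obtain m :: int where m: "\<i> * of_real (\<theta> k) * s = \<i> * of_real (\<theta> k) * s' + of_real (of_int (2 * m) * pi) * \<i>"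
      unfolding exp_eq by blast
    then have "\<i> * (of_real (\<theta> k) * (s - s')) = \<i> * of_real (2 * of_int m * pi)"
      by (simp add: algebra_simps)
    then have m': "of_real (\<theta> k) * (s - s') = complex_of_real (2 * of_int m * pi)"
      by simp
    from arg_cong[OF this, of Re] have re: "\<theta> k * (Re s - Re s') = 2 * of_int m * pi" by simp
    have "\<bar>Re s - Re s'\<bar> < 3 / 2" using Re_bd[OF s(1)] Re_bd[OF s(2)] \<delta>(2) by linarith
    moreover have "\<bar>\<theta> k\<bar> \<le> pi" using \<theta>(1)[of k] by auto
    ultimately have "\<bar>\<theta> k\<bar> * \<bar>Re s - Re s'\<bar> \<le> pi * (3 / 2)" by (intro mult_mono) auto
    then have "2 * \<bar>of_int m\<bar> * pi \<le> pi * (3 / 2)" using re by (simp flip: abs_mult) (simp add: abs_mult)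
    then have "\<bar>of_int m\<bar> < (1::real)" using pi_gt_zero by (simp add: field_simps)
    then have "m = 0" by linarith
    then show "s = s'" using m' \<theta>(2)[of k] by simp
  qed
  have fu: "iter f (p * n k) (z k) = Fin (h k 0)" for k
  proof -
    have "h k 0 = (f ^^ (p * n k)) (z k)" by (simp add: h_def u_def)
    moreover have "iter f (p * n k) (z k) \<noteq> Infty"
      by (rule fatou_set_iter_finite) (use zU Usub in blast)
    ultimately show ?thesis by (simp add: iter_eq_funpow)
  qed
  have "\<forall>k. \<exists>g. g holomorphic_on R \<and> g 0 = z k \<and> (\<forall>s\<in>R. iter f (p * n k) (g s) = Fin (h k s))"
    using lift_iterate[OF f R(1-3) h_hol h_P fu] by blast
  from choice[OF this] obtain G where G: "\<And>k. G k holomorphic_on R" "\<And>k. G k 0 = z k"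
    "\<And>k s. s \<in> R \<Longrightarrow> iter f (p * n k) (G k s) = Fin (h k s)" by blast
  \<comment> \<open>The arc lies in \<open>U\<close> before its end, so the end is a boundary point
    of a Fatou component and no Fatou point.\<close>
  have h1: "h k 1 \<notin> fatou_set f" for k
  proof (rule frontier_component_not_mem[OF fatou_set_open UF])
    show "h k 1 \<notin> U" using \<theta>(3)[of k] by (simp add: h_def)
    have lim: "((\<lambda>t. h k (of_real t)) \<longlongrightarrow> h k (of_real 1)) (at_left (1::real))"
      unfolding h_def by (intro tendsto_intros)
    have "eventually (\<lambda>t. h k (of_real t) \<in> closure U) (at_left (1::real))"
    proof -
      have "eventually (\<lambda>t. t \<in> {0<..<1}) (at_left (1::real))"
        by (rule eventually_at_left_real) simp
      then show ?thesis
      proof eventually_elim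
        case (elim t)
        then have "h k (of_real t) \<in> U" by (intro h_U) simp
        then show ?case using closure_subset by (rule rev_subsetD)
      qed
    qed
    from Lim_in_closed_set[OF closed_closure this _ lim] show "h k 1 \<in> closure U" by simp
  qed
  have nc: "\<not> f constant_on UNIV" using essential_nonconstant[OF ess] .
  have G1: "G k 1 \<notin> fatou_set f" for k
  proof
    assume "G k 1 \<in> fatou_set f"
    then have "(f ^^ (p * n k)) (G k 1) \<in> fatou_set f" by (rule fatou_set_funpow[OF f nc])
    moreover have "(f ^^ (p * n k)) (G k 1) = h k 1"
      using G(3)[OF R(4), of k] iter_eq_funpow[of f "p * n k" "G k 1"] by simp
    ultimately show False using h1 by simp
  qed
  have "seq_compact K" using K(1) by (rule compact_imp_seq_compact)
  moreover have "\<forall>k. z k \<in> K" using nz(2) by blast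
  ultimately obtain z' r where z': "z' \<in> K" and r: "strict_mono (r :: nat \<Rightarrow> nat)" "(z \<circ> r) \<longlonglongrightarrow> z'"
    by (rule seq_compactE)
  have "z' \<in> fatou_set f" using z' K(2) Usub by blast
  moreover have "filterlim (\<lambda>k. p * n (r k)) at_top sequentially"
  proof (rule filterlim_at_top_mono[OF filterlim_ident], rule always_eventually, rule allI)
    fix k
    have "k \<le> r k" using r(1) by (rule seq_suble)
    also have "\<dots> \<le> 1 * n (r k)" using nz(1)[of "r k"] by simp
    also have "\<dots> \<le> p * n (r k)" using p by (intro mult_le_mono1)
    finally show "k \<le> p * n (r k)" .
  qed
  moreover have "1 \<le> p * n (r k)" for k
    using p nz(1)[of "r k"] by (simp add: Suc_le_eq)
  moreover have "\<not> is_pole f z'"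
    using iter_finite_not_pole[OF fatou_set_iter_finite[OF \<open>z' \<in> fatou_set f\<close>], of 0] by simp
  moreover have "(\<lambda>k. G (r k) 0) \<longlonglongrightarrow> z'" using r(2) by (simp add: G(2) o_def)
  ultimately show False
    using inverse_branches_contradiction[OF f ess, of z' "\<lambda>k. p * n (r k)" R 0 1 "\<lambda>k. h (r k)" "\<lambda>k. G (r k)" z']
      R convex_connected[OF R(2)] h_inj G(1,3) G1 by blast
qed

section \<open>Radii reached by the iterates, and the choice of the sequence\<close>

text \<open>Under f^(pn) the path ends where its image under f^(p(n+1)) begins, so the successive
  images form a chain whose moduli leave no gap. The lower bound \<open>N\<close> on the order is
  carried along because the estimate near orbits holds only for late iterates.\<close>

lemma baker_orbit_hits_circles:
  assumes f: "f nicely_meromorphic_on UNIV" and B: "baker_domain f U p"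
  obtains K where "compact K" "K \<subseteq> U"
    "\<And>N. \<exists>b. \<forall>r\<ge>b. \<exists>n\<ge>N. \<exists>z\<in>K. cmod ((f ^^ (p * n)) z) = r"
proof -
  have UF: "U \<in> components (fatou_set f)" using B unfolding baker_domain_def by auto
  have Usub: "U \<subseteq> fatou_set f" using in_components_subset[OF UF] .
  obtain z0 where z0: "z0 \<in> U" using in_components_nonempty[OF UF] by blast
  have z1: "(f ^^ p) z0 \<in> U" using baker_domain_funpow_mem[OF B z0, of 1] by simp
  have "path_connected U"
    using open_components[OF fatou_set_open UF] in_components_connected[OF UF]
    by (simp add: connected_open_path_connected)
  then obtain \<gamma> where \<gamma>: "path \<gamma>" "path_image \<gamma> \<subseteq> U" "pathstart \<gamma> = z0" "pathfinish \<gamma> = (f ^^ p) z0"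
    using z0 z1 unfolding path_connected_def by blast
  define K where "K = path_image \<gamma>"
  have K: "compact K" "K \<subseteq> U" "connected K" "z0 \<in> K" "(f ^^ p) z0 \<in> K"
    using \<gamma> pathstart_in_path_image[of \<gamma>] pathfinish_in_path_image[of \<gamma>]
    by (auto simp: K_def compact_path_image connected_path_image)
  have conn: "connected ((\<lambda>z. cmod ((f ^^ (p * n)) z)) ` K)" for n
  proof -
    have "(f ^^ (p * n)) analytic_on K"
      using K(2) Usub by (intro iter_funpow_analytic[OF f] fatou_set_iter_finite) blast
    then have "continuous_on K (f ^^ (p * n))"
      by (intro holomorphic_on_imp_continuous_on analytic_imp_holomorphic)
    then show ?thesis using K(3) by (intro connected_continuous_image continuous_intros)
  qed
  show ?thesis
  proof (rule that[OF K(1,2)])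
    fix N
    have "\<exists>n\<ge>N. \<exists>z\<in>K. cmod ((f ^^ (p * n)) z) = r" if r: "r \<ge> cmod ((f ^^ (p * N)) z0)" for r
    proof -
      obtain M where M: "\<And>n. n \<ge> M \<Longrightarrow> cmod ((f ^^ (p * n)) z0) \<ge> r + 1"
        using baker_domain_escape[OF B K(1,2), of "r + 1"] K(4) by blast
      \<comment> \<open>The orbit of \<open>z0\<close> starts at order \<open>N\<close> with modulus
        at most \<open>r\<close> and later exceeds \<open>r\<close>; the first time it does so, the
        path joining the last two orbit points crosses the radius \<open>r\<close>.\<close>
      define Q where "Q m \<longleftrightarrow> r < cmod ((f ^^ (p * (N + m))) z0)" for m
      have "Q M" using M[of "N + M"] by (simp add: Q_def)
      moreover have "\<not> Q 0" using r by (simp add: Q_def)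
      ultimately obtain m where m: "\<not> Q m" "Q (Suc m)" 
        using ex_least_nat_less[of Q M] by blast
      define n where "n = N + m"
      have "p * (N + Suc m) = p * n + p" by (simp add: n_def)
      then have "(f ^^ (p * (N + Suc m))) z0 = (f ^^ (p * n)) ((f ^^ p) z0)"
        by (simp only: funpow_add o_apply)
      then have "cmod ((f ^^ (p * n)) z0) \<le> r" "r < cmod ((f ^^ (p * n)) ((f ^^ p) z0))"
        using m by (simp_all only: Q_def n_def not_less)
      then have "r \<in> (\<lambda>z. cmod ((f ^^ (p * n)) z)) ` K"
        using connected_contains_Icc[OF conn imageI[OF K(4)] imageI[OF K(5)], of n]
        by (meson atLeastAtMost_iff less_imp_le subsetD)
      then show ?thesis by (intro exI[of _ n]) (auto simp: n_def)
    qed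
    then show "\<exists>b. \<forall>r\<ge>b. \<exists>n\<ge>N. \<exists>z\<in>K. cmod ((f ^^ (p * n)) z) = r" by blast
  qed
qed

text \<open>Near-minimisers of \<open>\<phi>\<close> replace a diagonal argument.\<close>

lemma sequence_from_tolerances:
  fixes \<phi> :: "'a \<Rightarrow> nat \<Rightarrow> real"
  assumes ev: "\<And>\<epsilon>. \<epsilon> > 0 \<Longrightarrow> \<exists>b. \<forall>k\<ge>b. \<exists>q\<in>P. \<phi> q k \<le> \<epsilon>" and nonneg: "\<And>q k. \<phi> q k \<ge> 0"
  obtains q where "\<And>k. q k \<in> P" "(\<lambda>k. \<phi> (q k) k) \<longlonglongrightarrow> 0"
proof -
  have "P \<noteq> {}" using ev[of 1] by auto
  have bdd: "bdd_below ((\<lambda>q. \<phi> q k) ` P)" for k using nonneg by (intro bdd_belowI2[of _ 0])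
  define I where "I k = (INF q\<in>P. \<phi> q k)" for k
  have "\<exists>q\<in>P. \<phi> q k < I k + 1 / Suc k" for k
    using cINF_less_iff[OF \<open>P \<noteq> {}\<close> bdd, of k "I k + 1 / Suc k"] by (simp add: I_def)
  then obtain q where q: "\<And>k. q k \<in> P" "\<And>k. \<phi> (q k) k < I k + 1 / Suc k" by metis
  have "(\<lambda>k. \<phi> (q k) k) \<longlonglongrightarrow> 0"
  proof (rule LIMSEQ_I)
    fix e :: real assume "e > 0"
    obtain b where b: "\<And>k. k \<ge> b \<Longrightarrow> \<exists>q\<in>P. \<phi> q k \<le> e / 2" using ev[of "e / 2"] \<open>e > 0\<close> by auto
    obtain c where c: "1 / Suc c < e / 2" using \<open>e > 0\<close> nat_approx_posE[of "e / 2"] by auto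
    have "\<phi> (q k) k < e" if k: "k \<ge> max b c" for k
    proof -
      obtain q' where "q' \<in> P" "\<phi> q' k \<le> e / 2" using b[of k] k by auto
      then have "I k \<le> e / 2" unfolding I_def using cINF_lower2[OF bdd] by blast
      moreover have "1 / Suc k \<le> 1 / real (Suc c)" using k by (intro divide_left_mono) auto
      ultimately show ?thesis using q(2)[of k] c by linarith
    qed
    then show "\<exists>no. \<forall>n\<ge>no. norm (\<phi> (q n) n - 0) < e"
      using nonneg by (intro exI[of _ "max b c"]) auto
  qed
  then show ?thesis using that q(1) by blast
qed

theorem theoremA:
  fixes f :: "complex \<Rightarrow> complex" and U :: "complex set" and p :: nat
  assumes "f nicely_meromorphic_on UNIV"
    and "baker_domain f U p"
    and "\<exists>C\<in>components (- U). \<not> bounded C"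
  shows "\<exists>q :: nat \<Rightarrow> complex.
    (\<forall>n. q n \<in> postsingular_set f) \<and>
    filterlim (\<lambda>n. cmod (q n)) at_top sequentially \<and>
    (\<lambda>n. cmod (q (Suc n) / q n)) \<longlonglongrightarrow> 1 \<and>
    (\<lambda>n. infdist (q n) U / cmod (q n)) \<longlonglongrightarrow> 0"
proof -
  \<comment> \<open>The target radii are the integers \<open>k\<close>, as quotients of consecutive
    ones tend to 1. Both errors are measured relative to \<open>k\<close>; at \<open>k = 0\<close>
    the quotient is 0 by convention, without effect on the limit.\<close>
  define \<phi> where "\<phi> q k = max \<bar>cmod q - real k\<bar> (infdist q U) / real k" for q k
  obtain K where K: "compact K" "K \<subseteq> U"
    "\<And>N. \<exists>b. \<forall>r\<ge>b. \<exists>n\<ge>N. \<exists>z\<in>K. cmod ((f ^^ (p * n)) z) = r"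
    using baker_orbit_hits_circles[OF assms(1,2)] by blast
  have ev: "\<exists>b. \<forall>k\<ge>b. \<exists>q\<in>postsingular_set f. \<phi> q k \<le> \<epsilon>" if \<epsilon>: "\<epsilon> > 0" for \<epsilon>
  proof -
    obtain N where N: "\<And>n z. n \<ge> N \<Longrightarrow> z \<in> K \<Longrightarrow> \<exists>q\<in>postsingular_set f.
      \<bar>cmod q - cmod ((f ^^ (p * n)) z)\<bar> \<le> \<epsilon> * cmod ((f ^^ (p * n)) z) \<and>
      infdist q U \<le> \<epsilon> * cmod ((f ^^ (p * n)) z)"
      using postsingular_near_orbit[OF assms K(1,2) \<epsilon>] by blast
    obtain b where b: "\<And>r. r \<ge> b \<Longrightarrow> \<exists>n\<ge>N. \<exists>z\<in>K. cmod ((f ^^ (p * n)) z) = r"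
      using K(3)[of N] by blast
    \<comment> \<open>The successor makes \<open>k\<close> positive even when \<open>b\<close> is
      not.\<close>
    have "\<exists>q\<in>postsingular_set f. \<phi> q k \<le> \<epsilon>" if k: "k \<ge> Suc (nat \<lceil>b\<rceil>)" for k
    proof -
      have "real k \<ge> b" "real k > 0" using k by linarith+
      then obtain n z where "n \<ge> N" "z \<in> K" "cmod ((f ^^ (p * n)) z) = real k" using b by blast
      with N[of n z] obtain q where "q \<in> postsingular_set f"
        "\<bar>cmod q - real k\<bar> \<le> \<epsilon> * real k" "infdist q U \<le> \<epsilon> * real k" by auto
      then show ?thesis using \<open>real k > 0\<close> by (intro bexI[of _ q]) (auto simp: \<phi>_def divide_le_eq)
    qed
    then show ?thesis by blast
  qed
  obtain q where q: "\<And>k. q k \<in> postsingular_set f" "(\<lambda>k. \<phi> (q k) k) \<longlonglongrightarrow> 0"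
    by (rule sequence_from_tolerances[of "postsingular_set f" \<phi>]) (use ev in \<open>auto simp: \<phi>_def le_max_iff_disj\<close>)
  have pos: "eventually (\<lambda>k. real k > 0) sequentially"
    using eventually_gt_at_top[of 0] by eventually_elim simp
  \<comment> \<open>As \<open>x\<close> tends to 1, errors relative to the target \<open>k\<close>
    become errors relative to |q k|, and the quotients |q (k+1) / q k| behave like (k+1) /
    k.\<close>
  define x where "x k = cmod (q k) / real k" for k
  have x: "x \<longlonglongrightarrow> 1"
  proof (rule tendsto_dist_iff[THEN iffD2], rule tendsto_sandwich[OF _ _ tendsto_const q(2)])
    show "eventually (\<lambda>k. dist (x k) 1 \<le> \<phi> (q k) k) sequentially"
      using pos
    proof eventually_elim
      case (elim k)
      then have "x k - 1 = (cmod (q k) - real k) / real k" by (simp add: x_def field_simps)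
      then have "dist (x k) 1 = \<bar>cmod (q k) - real k\<bar> / real k" using elim by (simp add: dist_real_def)
      then show ?case using elim by (simp add: \<phi>_def divide_right_mono)
    qed
  qed auto
  have i: "(\<lambda>k. infdist (q k) U / real k) \<longlonglongrightarrow> 0"
  proof (rule tendsto_sandwich[OF _ _ tendsto_const q(2)])
    show "eventually (\<lambda>k. infdist (q k) U / real k \<le> \<phi> (q k) k) sequentially"
      by (intro always_eventually allI) (auto simp: \<phi>_def intro!: divide_right_mono)
  qed (auto simp: infdist_nonneg)
  have xk: "filterlim (\<lambda>k. x k * real k) at_top sequentially"
    by (rule filterlim_tendsto_pos_mult_at_top[OF x _ filterlim_real_sequentially]) simp
  have "eventually (\<lambda>k. x k * real k = cmod (q k)) sequentially"
    using pos by eventually_elim (simp add: x_def)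
  from filterlim_cong[OF refl refl this] have "filterlim (\<lambda>k. cmod (q k)) at_top sequentially"
    using xk by simp
  moreover have "(\<lambda>k. cmod (q (Suc k) / q k)) \<longlonglongrightarrow> 1"
  proof -
    have "(\<lambda>k. x (Suc k) * (real (Suc k) / real k) / x k) \<longlonglongrightarrow> 1 * 1 / 1"
      by (intro tendsto_intros LIMSEQ_Suc[OF x] x) (real_asymp, simp)
    moreover have "eventually (\<lambda>k. x (Suc k) * (real (Suc k) / real k) / x k = cmod (q (Suc k) / q k)) sequentially"
      using pos by eventually_elim (simp add: x_def norm_divide)
    ultimately show ?thesis using Lim_transform_eventually by fastforce
  qed
  moreover have "(\<lambda>k. infdist (q k) U / cmod (q k)) \<longlonglongrightarrow> 0"
  proof -
    have "(\<lambda>k. (infdist (q k) U / real k) / x k) \<longlonglongrightarrow> 0 / 1"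
      by (intro tendsto_divide i x) simp
    moreover have "eventually (\<lambda>k. (infdist (q k) U / real k) / x k = infdist (q k) U / cmod (q k)) sequentially"
      using pos by eventually_elim (simp add: x_def)
    ultimately show ?thesis using Lim_transform_eventually by fastforce
  qed
  ultimately show ?thesis using q(1) by blast
qed

end
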